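(* Let $P(\partial_t,D_x)=\partial_t^m+\sum_{k=1}^m a_k(D_x)\partial_t^{m-k}$, where $m\ge1$ and $a_k(\xi)$, $1\le k\le m$, are polynomials on $\mathbb{R}^d$. Assume that $P(\partial_t,D_x)$ is hyperbolic with respect to $t$. Then there is a constant $C_0>0$ such that $$(\tau,\zeta)\in\mathbb{C}\times\mathbb{C}^d,\quad P(i\tau,\zeta)=0\ \Longrightarrow\ \operatorname{Im}\tau\ge-C_0(1+|\operatorname{Im}\zeta|),$$ and hence, if $g\in S^{1/2}_{1/2}(\mathbb{R}^d)$, for every $t\ge0$ the propagator $\sigma(t,D_x)$ satisfies $$|\langle\sigma(t,D_x)\pi(z)g,\pi(w)g\rangle|\le C\exp\big(-\epsilon|w-z|^2\big)\qquad\text{for all }z,w\in\mathbb{R}^{2d},$$ for some constants $\epsilon>0$ and $C>0$.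
   Context: Here $t\in\mathbb{R}$, $x\in\mathbb{R}^d$, $D_{x_j}=\frac{1}{2\pi i}\partial_{x_j}$; the $a_k$ may have complex coefficients and be non-homogeneous. $P(i\tau,\zeta)=(i\tau)^m+\sum_{k=1}^m a_k(\zeta)(i\tau)^{m-k}$ is the symbol of $P$. Hyperbolicity: $P(\partial_t,D_x)$ is hyperbolic with respect to $t$ if (a) the direction $N=(1,0,\dots,0)\in\mathbb{R}\times\mathbb{R}^d$ is non-characteristic for $P$, i.e. the principal symbol (the highest-order homogeneous part of the symbol $P(i\tau,\xi)$ as a polynomial in $(\tau,\xi)$) does not vanish at $N$; and (b) the forward Hadamard-Petrowsky condition holds: there is $C>0$ such that $(\tau,\xi)\in\mathbb{C}\times\mathbb{R}^d$, $P(i\tau,\xi)=0$ imply $\operatorname{Im}\tau\ge-C$. (Strict hyperbolicity is not required.) The symbol $\sigma(t,\xi)$ of the propagator is, for each $\xi$, the unique solution of $$\Big(\partial_t^m+\sum_{k=1}^m a_k(\xi)\partial_t^{m-k}\Big)\sigma(t,\xi)=\delta(t)$$ supported in $[0,+\infty)\times\mathbb{R}^d$; equivalently, for $t\ge0$, $\sigma(\cdot,\xi)$ solves the homogeneous ODE with $\partial_t^k\sigma(0,\xi)=0$ for $0\le k\le m-2$ and $\partial_t^{m-1}\sigma(0,\xi)=1$ (values at $t=0$ taken from the right). The propagator is the Fourier multiplier $\sigma(t,D_x)f=\mathcal{F}^{-1}(\sigma(t,\cdot)\mathcal{F}f)$, with $\mathcal{F}f(\xi)=\int f(x)e^{-2\pi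 ix\cdot\xi}\,dx$. For $z=(x,\xi)\in\mathbb{R}^{2d}$, $\pi(z)f(y)=e^{2\pi i\xi\cdot y}f(y-x)$; $\langle f,g\rangle=\int f\overline g$. $S^{1/2}_{1/2}(\mathbb{R}^d)$ is the Gelfand-Shilov space of $f\in\mathcal{S}(\mathbb{R}^d)$ such that for some $A,B,c>0$, $|x^\alpha\partial^\beta f(x)|\le cA^{|\alpha|}B^{|\beta|}(\alpha!)^{1/2}(\beta!)^{1/2}$ for all $x\in\mathbb{R}^d$, $\alpha,\beta\in\mathbb{N}^d$. *)

theory Defs
  imports "HOL-Analysis.Analysis" "HOL-Library.Poly_Mapping"
begin

section \<open>Polynomials in finitely many variables\<close>

text \<open>A polynomial with complex coefficients in the variables indexed by \<open>'n\<close>,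
  as a finitely supported map from multi-indices to coefficients.\<close>

type_synonym 'n cpoly = "('n \<Rightarrow> nat) \<Rightarrow>\<^sub>0 complex"

definition multi_deg :: "('n::finite \<Rightarrow> nat) \<Rightarrow> nat" where
  "multi_deg \<alpha> = (\<Sum>j\<in>UNIV. \<alpha> j)"

definition multi_fact :: "('n::finite \<Rightarrow> nat) \<Rightarrow> real" where
  "multi_fact \<alpha> = (\<Prod>j\<in>UNIV. fact (\<alpha> j))"

definition multi_power :: "'b::comm_monoid_mult ^ 'n::finite \<Rightarrow> ('n \<Rightarrow> nat) \<Rightarrow> 'b" where
  "multi_power z \<alpha> = (\<Prod>j\<in>UNIV. (z $ j) ^ \<alpha> j)"

definition cpoly_eval :: "'n::finite cpoly \<Rightarrow> complex ^ 'n \<Rightarrow> complex" where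
  "cpoly_eval p z = (\<Sum>\<alpha>\<in>Poly_Mapping.keys p. Poly_Mapping.lookup p \<alpha> * multi_power z \<alpha>)"

definition cpoly_degree :: "'n::finite cpoly \<Rightarrow> nat" where
  "cpoly_degree p = Max (insert 0 (multi_deg ` Poly_Mapping.keys p))"

text \<open>Evaluation of the homogeneous part of highest degree.\<close>

definition principal_eval :: "'n::finite cpoly \<Rightarrow> complex ^ 'n \<Rightarrow> complex" where
  "principal_eval p z =
     (\<Sum>\<alpha>\<in>{\<alpha> \<in> Poly_Mapping.keys p. multi_deg \<alpha> = cpoly_degree p}.
        Poly_Mapping.lookup p \<alpha> * multi_power z \<alpha>)"

definition complex_vec :: "real ^ 'd \<Rightarrow> complex ^ 'd" where
  "complex_vec \<xi> = (\<chi> j. complex_of_real (\<xi> $ j))"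

definition Im_vec :: "complex ^ 'd \<Rightarrow> real ^ 'd" where
  "Im_vec \<zeta> = (\<chi> j. Im (\<zeta> $ j))"


section \<open>Hyperbolic operators\<close>

text \<open>The operator \<open>P(\<partial>\<^sub>t, D\<^sub>x)\<close> is given by its order \<open>m\<close> in \<open>t\<close> and its coefficients
  \<open>a 1, \<dots>, a m\<close>; other values of \<open>a\<close> are never used.
  \<open>op_symbol m a s \<zeta>\<close> is \<open>P(s, \<zeta>)\<close>, to be used with \<open>s = \<i> \<tau>\<close>.\<close>

definition op_symbol ::
    "nat \<Rightarrow> (nat \<Rightarrow> 'd::finite cpoly) \<Rightarrow> complex \<Rightarrow> complex ^ 'd \<Rightarrow> complex" where
  "op_symbol m a s \<zeta> = s ^ m + (\<Sum>k=1..m. cpoly_eval (a k) \<zeta> * s ^ (m - k))"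

text \<open>\<open>P(\<i> \<tau>, \<xi>)\<close> as a polynomial in the \<open>1 + d\<close> variables \<open>(\<tau>, \<xi>)\<close>: the index \<open>None\<close>
  stands for \<open>\<tau>\<close> and \<open>Some j\<close> for \<open>\<xi>\<^sub>j\<close>.\<close>

definition symbol_cpoly :: "nat \<Rightarrow> (nat \<Rightarrow> 'd::finite cpoly) \<Rightarrow> 'd option cpoly" where
  "symbol_cpoly m a =
     Poly_Mapping.single (case_option m (\<lambda>_. 0)) (\<i> ^ m) +
     (\<Sum>k=1..m. \<Sum>\<alpha>\<in>Poly_Mapping.keys (a k).
        Poly_Mapping.single (case_option (m - k) \<alpha>) (Poly_Mapping.lookup (a k) \<alpha> * \<i> ^ (m - k)))"

definition time_direction :: "complex ^ 'd::finite option" where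
  "time_direction = (\<chi> j. case j of None \<Rightarrow> 1 | Some _ \<Rightarrow> 0)"

definition hyperbolic :: "nat \<Rightarrow> (nat \<Rightarrow> 'd::finite cpoly) \<Rightarrow> bool" where
  "hyperbolic m a \<longleftrightarrow>
     principal_eval (symbol_cpoly m a) time_direction \<noteq> 0 \<and>
     (\<exists>C>0. \<forall>(\<tau>::complex) (\<xi>::real ^ 'd).
        op_symbol m a (\<i> * \<tau>) (complex_vec \<xi>) = 0 \<longrightarrow> Im \<tau> \<ge> - C)"

lemma cpoly_eval_zero: "cpoly_eval 0 z = 0"
  by (simp add: cpoly_eval_def)

lemma cpoly_eval_superset:
  assumes "finite A" "Poly_Mapping.keys p \<subseteq> A"
  shows "cpoly_eval p z = (\<Sum>\<alpha>\<in>A. Poly_Mapping.lookup p \<alpha> * multi_power z \<alpha>)"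
  unfolding cpoly_eval_def using assms
  by (intro sum.mono_neutral_left) (auto simp: in_keys_iff)

lemma cpoly_eval_add: "cpoly_eval (p + q) z = cpoly_eval p z + cpoly_eval q z"
proof -
  let ?A = "Poly_Mapping.keys p \<union> Poly_Mapping.keys q"
  have "cpoly_eval r z = (\<Sum>\<alpha>\<in>?A. Poly_Mapping.lookup r \<alpha> * multi_power z \<alpha>)" if "r \<in> {p, q, p + q}" for r
    using that keys_add[of p q] by (intro cpoly_eval_superset) auto
  then show ?thesis
    by (simp add: lookup_add sum.distrib distrib_right)
qed

lemma cpoly_eval_sum: "cpoly_eval (\<Sum>i\<in>I. p i) z = (\<Sum>i\<in>I. cpoly_eval (p i) z)"
  by (induction I rule: infinite_finite_induct) (auto simp: cpoly_eval_add cpoly_eval_zero)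

lemma cpoly_eval_single: "cpoly_eval (Poly_Mapping.single \<alpha> c) z = c * multi_power z \<alpha>"
  by (simp add: cpoly_eval_def)

lemma multi_power_option:
  "multi_power (\<chi> j. case j of None \<Rightarrow> \<tau> | Some i \<Rightarrow> \<zeta> $ i) (case_option n \<alpha>)
     = \<tau> ^ n * multi_power \<zeta> \<alpha>"
  by (simp add: multi_power_def UNIV_option_conv prod.reindex)

lemma symbol_cpoly_eval:
  "cpoly_eval (symbol_cpoly m a) (\<chi> j. case j of None \<Rightarrow> \<tau> | Some i \<Rightarrow> \<zeta> $ i)
     = op_symbol m a (\<i> * \<tau>) \<zeta>"
proof -
  have "multi_power \<zeta> (\<lambda>_. 0) = 1"
    by (simp add: multi_power_def)
  then show ?thesis
    by (simp add: symbol_cpoly_def op_symbol_def cpoly_eval_add cpoly_eval_sum cpoly_eval_single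
        multi_power_option power_mult_distrib sum_distrib_right sum_distrib_left
        cpoly_eval_def[of "a _"] mult_ac)
qed


section \<open>The propagator\<close>

text \<open>The solution supported in \<open>[0, \<infinity>)\<close> of
  \<open>s\<^sup>(\<^sup>m\<^sup>) + \<Sum>\<^sub>k c\<^sub>k s\<^sup>(\<^sup>m\<^sup>-\<^sup>k\<^sup>) = \<delta>\<close>, expressed by the Cauchy problem on \<open>[0, \<infinity>)\<close> with one-sided
  derivatives at \<open>0\<close>; \<open>u k\<close> is the \<open>k\<close>-th derivative of \<open>s\<close> there, and \<open>s 0\<close> is the limit from
  the right.\<close>

definition fundamental_solution :: "nat \<Rightarrow> (nat \<Rightarrow> complex) \<Rightarrow> (real \<Rightarrow> complex) \<Rightarrow> bool" where
  "fundamental_solution m c s \<longleftrightarrow>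
     (\<forall>t<0. s t = 0) \<and>
     (\<exists>u :: nat \<Rightarrow> real \<Rightarrow> complex.
        (\<forall>t\<ge>0. u 0 t = s t) \<and>
        (\<forall>k<m. \<forall>t\<ge>0. (u k has_vector_derivative u (Suc k) t) (at t within {0..})) \<and>
        (\<forall>k. Suc k < m \<longrightarrow> u k 0 = 0) \<and> u (m - 1) 0 = 1 \<and>
        (\<forall>t\<ge>0. u m t + (\<Sum>k=1..m. c k * u (m - k) t) = 0))"

text \<open>Existence (by power series) and uniqueness (by an energy estimate).\<close>

fun taylor_coeff :: "nat \<Rightarrow> (nat \<Rightarrow> complex) \<Rightarrow> nat \<Rightarrow> complex" where
  "taylor_coeff m c n = (if Suc n < m then 0 else if Suc n = m \<or> m = 0 then 1
     else - (\<Sum>k=1..m. c k * taylor_coeff m c (n - k)))"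

declare taylor_coeff.simps [simp del]

lemma taylor_coeff_bound:
  "norm (taylor_coeff m c n) \<le> (1 + (\<Sum>k=1..m. norm (c k))) ^ n"
proof (induction n rule: less_induct)
  case (less n)
  define M where "M = 1 + (\<Sum>k=1..m. norm (c k))"
  have M: "M \<ge> 1"
    by (simp add: M_def sum_nonneg)
  show ?case
  proof (cases "Suc n \<le> m \<or> m = 0")
    case True
    then show ?thesis
      using one_le_power[OF M, of n] M by (auto simp: taylor_coeff.simps[of m c n] M_def)
  next
    case False
    then have n: "m \<le> n" "m > 0" by auto
    have "norm (taylor_coeff m c n) \<le> (\<Sum>k=1..m. norm (c k * taylor_coeff m c (n - k)))"
      using False by (subst taylor_coeff.simps) (auto intro: norm_sum)
    also have "\<dots> \<le> (\<Sum>k=1..m. norm (c k) * M ^ (n - 1))"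
    proof (rule sum_mono)
      fix k assume k: "k \<in> {1..m}"
      have "norm (taylor_coeff m c (n - k)) \<le> M ^ (n - k)"
        using less[of "n - k"] k n by (simp add: M_def)
      also have "\<dots> \<le> M ^ (n - 1)"
        using M k by (intro power_increasing) auto
      finally show "norm (c k * taylor_coeff m c (n - k)) \<le> norm (c k) * M ^ (n - 1)"
        by (simp add: norm_mult mult_left_mono)
    qed
    also have "\<dots> = (M - 1) * M ^ (n - 1)"
      by (simp add: M_def sum_distrib_right)
    also have "\<dots> \<le> M * M ^ (n - 1)"
      using M by (intro mult_right_mono) auto
    also have "\<dots> = M ^ n"
      using n by (cases n) auto
    finally show ?thesis by (simp add: M_def)
  qed
qed

lemma fundamental_solution_exists:
  assumes "m \<ge> 1"
  shows "\<exists>s. fundamental_solution m c s"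
proof -
  define M where "M = 1 + (\<Sum>k=1..m. norm (c k))"
  have M: "M \<ge> 1"
    by (simp add: M_def sum_nonneg)
  define b where "b k n = taylor_coeff m c (n + k) / fact n" for k n
  define u where "u k t = suminf (\<lambda>n. b k n * complex_of_real t ^ n)" for k t
  have summ: "summable (\<lambda>n. b k n * z ^ n)" for k and z :: complex
  proof (rule summable_comparison_test')
    show "summable (\<lambda>n. M ^ k * ((M * norm z) ^ n /\<^sub>R fact n))"
      by (intro summable_mult summable_exp_generic)
    fix n
    have "norm (taylor_coeff m c (n + k)) \<le> M ^ (n + k)"
      using taylor_coeff_bound[of m c "n + k"] by (simp add: M_def)
    then have "norm (taylor_coeff m c (n + k)) * (norm z ^ n / fact n) \<le> M ^ (n + k) * (norm z ^ n / fact n)"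
      by (rule mult_right_mono) auto
    then show "norm (b k n * z ^ n) \<le> M ^ k * ((M * norm z) ^ n /\<^sub>R fact n)"
      by (simp add: b_def norm_mult norm_divide norm_power power_add power_mult_distrib field_simps)
  qed
  have diffs_b: "diffs (b k) n = b (Suc k) n" for k n
    by (simp add: diffs_def b_def divide_simps del: of_nat_Suc)
  have deriv: "(u k has_vector_derivative u (Suc k) t) (at t within S)" for k t S
  proof -
    have "((\<lambda>z. suminf (\<lambda>n. b k n * z ^ n)) has_field_derivative u (Suc k) t) (at (complex_of_real t))"
      using termdiffs_strong_converges_everywhere[of "b k" "complex_of_real t"] summ
      by (simp add: diffs_b u_def)
    then show ?thesis
      unfolding u_def[of k, abs_def] by (rule has_vector_derivative_real_field)
  qed
  have init: "u k 0 = taylor_coeff m c k" for k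
    unfolding u_def by simp (simp add: b_def)
  have ode: "u m t + (\<Sum>k=1..m. c k * u (m - k) t) = 0" for t
  proof -
    let ?z = "complex_of_real t"
    have "(\<lambda>n. b m n * ?z ^ n + (\<Sum>k=1..m. c k * (b (m - k) n * ?z ^ n))) sums
        (u m t + (\<Sum>k=1..m. c k * u (m - k) t))"
      unfolding u_def by (intro sums_add sums_sum sums_mult summable_sums summ)
    moreover have "b m n * ?z ^ n + (\<Sum>k=1..m. c k * (b (m - k) n * ?z ^ n)) = 0" for n
    proof -
      have "taylor_coeff m c (n + m) = - (\<Sum>k=1..m. c k * taylor_coeff m c (n + (m - k)))"
        using assms by (subst taylor_coeff.simps) (auto intro!: sum.cong)
      then have "b m n = - (\<Sum>k=1..m. c k * b (m - k) n)"
        by (simp add: b_def sum_divide_distrib)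
      then show ?thesis
        by (simp add: sum_distrib_right mult.assoc)
    qed
    ultimately show ?thesis
      by (simp add: sums_iff)
  qed
  have "fundamental_solution m c (\<lambda>t. if t < 0 then 0 else u 0 t)"
    unfolding fundamental_solution_def
    using deriv ode init assms
    by (intro conjI exI[of _ u]) (auto simp: taylor_coeff.simps[of m c])
  then show ?thesis by blast
qed

lemma fundamental_solution_unique:
  assumes "m \<ge> 1" "fundamental_solution m c s" "fundamental_solution m c s'"
  shows "s = s'"
proof -
  from assms(2) obtain u where u_all:
    "\<forall>t\<ge>0. u 0 t = s t"
    "\<forall>k<m. \<forall>t\<ge>0. (u k has_vector_derivative u (Suc k) t) (at t within {0..})"
    "\<forall>k. Suc k < m \<longrightarrow> u k 0 = 0" "u (m - 1) 0 = 1"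
    "\<forall>t\<ge>0. u m t + (\<Sum>k=1..m. c k * u (m - k) t) = 0" "\<forall>t<0. s t = 0"
    unfolding fundamental_solution_def by (elim conjE exE) (rule that; assumption)
  note u = u_all[rule_format]
  from assms(3) obtain v where v_all:
    "\<forall>t\<ge>0. v 0 t = s' t"
    "\<forall>k<m. \<forall>t\<ge>0. (v k has_vector_derivative v (Suc k) t) (at t within {0..})"
    "\<forall>k. Suc k < m \<longrightarrow> v k 0 = 0" "v (m - 1) 0 = 1"
    "\<forall>t\<ge>0. v m t + (\<Sum>k=1..m. c k * v (m - k) t) = 0" "\<forall>t<0. s' t = 0"
    unfolding fundamental_solution_def by (elim conjE exE) (rule that; assumption)
  note v = v_all[rule_format]
  define w where "w k t = u k t - v k t" for k t
  have w_deriv: "(w k has_vector_derivative w (Suc k) t) (at t within {0..})"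
    if "k < m" "t \<ge> 0" for k t
    unfolding w_def using that u(2) v(2) by (intro derivative_intros) auto
  have w_init: "w k 0 = 0" if "k < m" for k
  proof (cases "Suc k < m")
    case True
    then show ?thesis by (simp add: w_def u(3) v(3))
  next
    case False
    with that have "k = m - 1" by simp
    then show ?thesis by (simp add: w_def u(4)[simplified] v(4)[simplified])
  qed
  have w_ode: "w m t = - (\<Sum>k=1..m. c k * w (m - k) t)" if "t \<ge> 0" for t
    using u(5)[OF that] v(5)[OF that]
    by (simp add: w_def right_diff_distrib sum_subtractf add_eq_0_iff2)
  define S where "S = (\<Sum>k=1..m. norm (c k))"
  define K where "K = real m * (2 + S\<^sup>2)"
  define E where "E t = (\<Sum>k<m. w k t \<bullet> w k t)" for t
  define E' where "E' t = (\<Sum>k<m. 2 * (w k t \<bullet> w (Suc k) t))" for t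
  have E_nonneg: "E t \<ge> 0" for t
    by (simp add: E_def sum_nonneg)
  have w_le: "(norm (w k t))\<^sup>2 \<le> E t" if "k < m" for k t
    unfolding E_def dot_square_norm using that by (intro member_le_sum) auto
  have w_m: "(norm (w m t))\<^sup>2 \<le> S\<^sup>2 * E t" if "t \<ge> 0" for t
  proof -
    have "norm (w m t) \<le> (\<Sum>k=1..m. norm (c k) * norm (w (m - k) t))"
      unfolding w_ode[OF that] by (simp add: norm_mult[symmetric] norm_sum)
    also have "\<dots> \<le> (\<Sum>k=1..m. norm (c k) * sqrt (E t))"
      by (intro sum_mono mult_left_mono real_le_rsqrt w_le) auto
    also have "\<dots> = S * sqrt (E t)"
      by (simp add: S_def sum_distrib_right)
    finally have "(norm (w m t))\<^sup>2 \<le> (S * sqrt (E t))\<^sup>2"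
      by (intro power_mono) auto
    then show ?thesis using E_nonneg by (simp add: power_mult_distrib)
  qed
  have E_deriv: "(E has_real_derivative E' t) (at t within {0..})" if "t \<ge> 0" for t
    unfolding E_def E'_def has_real_derivative_iff_has_vector_derivative
  proof (rule has_vector_derivative_sum)
    fix k assume "k \<in> {..<m}"
    then have "((\<lambda>t. w k t \<bullet> w k t) has_vector_derivative
        (w k t \<bullet> w (Suc k) t + w (Suc k) t \<bullet> w k t)) (at t within {0..})"
      using that
      by (intro bounded_bilinear.has_vector_derivative[OF bounded_bilinear_inner] w_deriv) auto
    then show "((\<lambda>t. w k t \<bullet> w k t) has_vector_derivative 2 * (w k t \<bullet> w (Suc k) t)) (at t within {0..})"
      by (simp add: inner_commute)
  qed
  have E'_le: "E' t \<le> K * E t" if "t \<ge> 0" for t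
  proof -
    have "E' t \<le> (\<Sum>k<m. (2 + S\<^sup>2) * E t)"
      unfolding E'_def
    proof (rule sum_mono)
      fix k assume k: "k \<in> {..<m}"
      have "0 \<le> (norm (w k t - w (Suc k) t))\<^sup>2" by simp
      then have "2 * (w k t \<bullet> w (Suc k) t) \<le> (norm (w k t))\<^sup>2 + (norm (w (Suc k) t))\<^sup>2"
        by (simp add: power2_norm_eq_inner inner_diff_left inner_diff_right inner_commute)
      moreover have "(norm (w (Suc k) t))\<^sup>2 \<le> (1 + S\<^sup>2) * E t"
      proof (cases "Suc k = m")
        case True
        then show ?thesis using w_m[OF that] E_nonneg[of t] by (simp add: algebra_simps)
      next
        case False
        with k have "(norm (w (Suc k) t))\<^sup>2 \<le> E t" by (intro w_le) auto
        moreover have "0 \<le> S\<^sup>2 * E t" using E_nonneg by simp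
        ultimately show ?thesis by (simp add: algebra_simps)
      qed
      ultimately show "2 * (w k t \<bullet> w (Suc k) t) \<le> (2 + S\<^sup>2) * E t"
        using w_le[of k t] k by (simp add: algebra_simps)
    qed
    then show ?thesis by (simp add: K_def mult_ac)
  qed
  have "E t = 0" if t: "t \<ge> 0" for t
  proof -
    define F where "F r = E r * exp (- K * r)" for r
    have F_deriv: "(F has_real_derivative (E' r - K * E r) * exp (- K * r)) (at r within {0..})"
      if "r \<ge> 0" for r
      unfolding F_def using E_deriv[OF that]
      by (auto intro!: derivative_eq_intros simp: algebra_simps)
    have "F t \<le> F 0"
    proof (rule DERIV_nonpos_imp_decreasing_open[OF t])
      fix r assume r: "0 < r" "r < t"
      have "(F has_real_derivative (E' r - K * E r) * exp (- K * r)) (at r)"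
        using F_deriv[of r] r by (simp add: at_within_interior[of r "{0..}"])
      then show "\<exists>y. (F has_real_derivative y) (at r) \<and> y \<le> 0"
        using E'_le[of r] r by (intro exI conjI) (auto simp: mult_nonpos_nonneg)
    next
      have "continuous_on {0..} F"
        using F_deriv by (auto simp: continuous_on_eq_continuous_within intro: DERIV_continuous)
      then show "continuous_on {0..t} F"
        by (rule continuous_on_subset) auto
    qed
    moreover have "F 0 = 0"
      by (simp add: F_def E_def w_init)
    ultimately show ?thesis
      using E_nonneg[of t] by (simp add: F_def mult_le_0_iff)
  qed
  then have "w 0 t = 0" if "t \<ge> 0" for t
    using w_le[of 0 t] assms(1) that by simp
  then show ?thesis
    using u(1,6) v(1,6) by (intro ext) (metis w_def eq_iff_diff_eq_0 not_le)
qed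

lemma fundamental_solution_ex1:
  "m \<ge> 1 \<Longrightarrow> \<exists>!s. fundamental_solution m c s"
  using fundamental_solution_exists fundamental_solution_unique by blast

definition propagator_symbol ::
    "nat \<Rightarrow> (nat \<Rightarrow> 'd::finite cpoly) \<Rightarrow> real \<Rightarrow> real ^ 'd \<Rightarrow> complex" where
  "propagator_symbol m a t \<xi> =
     (THE s. fundamental_solution m (\<lambda>k. cpoly_eval (a k) (complex_vec \<xi>)) s) t"

definition fourier :: "(real ^ 'd::finite \<Rightarrow> complex) \<Rightarrow> real ^ 'd \<Rightarrow> complex" where
  "fourier f \<xi> = (LINT x|lborel. f x * exp (- 2 * of_real pi * \<i> * of_real (x \<bullet> \<xi>)))"

definition inverse_fourier :: "(real ^ 'd::finite \<Rightarrow> complex) \<Rightarrow> real ^ 'd \<Rightarrow> complex" where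
  "inverse_fourier h x = (LINT \<xi>|lborel. h \<xi> * exp (2 * of_real pi * \<i> * of_real (x \<bullet> \<xi>)))"

definition fourier_multiplier ::
    "(real ^ 'd::finite \<Rightarrow> complex) \<Rightarrow> (real ^ 'd \<Rightarrow> complex) \<Rightarrow> real ^ 'd \<Rightarrow> complex" where
  "fourier_multiplier \<mu> f = inverse_fourier (\<lambda>\<xi>. \<mu> \<xi> * fourier f \<xi>)"

definition propagator ::
    "nat \<Rightarrow> (nat \<Rightarrow> 'd::finite cpoly) \<Rightarrow> real \<Rightarrow> (real ^ 'd \<Rightarrow> complex) \<Rightarrow> real ^ 'd \<Rightarrow> complex" where
  "propagator m a t = fourier_multiplier (propagator_symbol m a t)"


section \<open>Time-frequency shifts and Gelfand--Shilov spaces\<close>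

definition tf_shift ::
    "(real ^ 'd::finite) \<times> (real ^ 'd) \<Rightarrow> (real ^ 'd \<Rightarrow> complex) \<Rightarrow> real ^ 'd \<Rightarrow> complex" where
  "tf_shift z f y = (case z of (x, \<xi>) \<Rightarrow> exp (2 * of_real pi * \<i> * of_real (\<xi> \<bullet> y)) * f (y - x))"

definition L2_pairing ::
    "(real ^ 'd::finite \<Rightarrow> complex) \<Rightarrow> (real ^ 'd \<Rightarrow> complex) \<Rightarrow> complex" where
  "L2_pairing f g = (LINT y|lborel. f y * cnj (g y))"

definition partial_deriv ::
    "'d::finite \<Rightarrow> (real ^ 'd \<Rightarrow> complex) \<Rightarrow> real ^ 'd \<Rightarrow> complex" where
  "partial_deriv j f x = vector_derivative (\<lambda>s. f (x + s *\<^sub>R axis j 1)) (at 0)"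

primrec iter_partial ::
    "'d::finite list \<Rightarrow> (real ^ 'd \<Rightarrow> complex) \<Rightarrow> real ^ 'd \<Rightarrow> complex" where
  "iter_partial [] f = f"
| "iter_partial (j # js) f = partial_deriv j (iter_partial js f)"

text \<open>\<open>C\<^sup>\<infinity>\<close>: all iterated partial derivatives exist and are continuous; since this concerns all
  orders, it amounts to total differentiability of all of them.\<close>

definition smooth_fun :: "(real ^ 'd::finite \<Rightarrow> complex) \<Rightarrow> bool" where
  "smooth_fun f \<longleftrightarrow> (\<forall>js x. iter_partial js f differentiable (at x))"

text \<open>\<open>\<partial>\<^sup>\<beta> f\<close>. The order of differentiation is an arbitrary one with \<open>\<beta> j\<close> occurrences of each
  \<open>j\<close>; it is irrelevant for smooth functions, the only ones to which this is applied.\<close>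

definition multi_partial ::
    "('d::finite \<Rightarrow> nat) \<Rightarrow> (real ^ 'd \<Rightarrow> complex) \<Rightarrow> real ^ 'd \<Rightarrow> complex" where
  "multi_partial \<beta> = iter_partial (SOME js. \<forall>j. count_list js j = \<beta> j)"

lemma ex_list_count: "\<exists>js. \<forall>j. count_list js j = \<beta> j" for \<beta> :: "'d::finite \<Rightarrow> nat"
proof -
  obtain xs :: "'d list" where xs: "set xs = UNIV" "distinct xs"
    using finite_distinct_list[OF finite] by blast
  have rep: "count_list (replicate n a) j = (if a = j then n else 0)" for n and a j :: 'd
    by (induction n) auto
  have *: "count_list (concat (map (\<lambda>j. replicate (\<beta> j) j) ys)) j = (if j \<in> set ys then \<beta> j else 0)"
    if "distinct ys" for ys j
    using that by (induction ys) (auto simp: count_list_append rep)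
  show ?thesis
    using *[OF xs(2)] xs(1) by (metis UNIV_I)
qed

definition schwartz :: "(real ^ 'd::finite \<Rightarrow> complex) set" where
  "schwartz = {f. smooth_fun f \<and>
     (\<forall>\<alpha> \<beta>. bounded (range (\<lambda>x. multi_power x \<alpha> *\<^sub>R multi_partial \<beta> f x)))}"

text \<open>\<open>gelfand_shilov r s\<close> is \<open>S\<^sup>s\<^sub>r\<close>: the exponent \<open>r\<close> governs decay and \<open>s\<close> regularity.\<close>

definition gelfand_shilov :: "real \<Rightarrow> real \<Rightarrow> (real ^ 'd::finite \<Rightarrow> complex) set" where
  "gelfand_shilov r s = {f \<in> schwartz. \<exists>A>0. \<exists>B>0. \<exists>c>0. \<forall>x \<alpha> \<beta>.
     norm (multi_power x \<alpha> *\<^sub>R multi_partial \<beta> f x)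
       \<le> c * A ^ multi_deg \<alpha> * B ^ multi_deg \<beta> * multi_fact \<alpha> powr r * multi_fact \<beta> powr s}"

end

theory Submission
  imports
    Defs
    "HOL-Complex_Analysis.Complex_Analysis"
    "HOL-Computational_Algebra.Fundamental_Theorem_Algebra"
    "HOL-Probability.Distributions"
begin

text \<open>Hyperbolicity forces \<open>a k\<close> to have degree at most \<open>k\<close>, so the roots satisfy
  \<open>|\<tau>| \<le> A (1 + |\<zeta>|)\<close>. Tilt the frequency direction into the time direction: with \<open>L\<close> large,
  consider the zeros \<open>w\<close> of \<open>P(s + \<i> x + \<i> L w, \<xi> + w \<eta>)\<close> in the lower half plane. The root bound
  excludes them for large \<open>s\<close>, hyperbolicity keeps them off the real axis for \<open>s > C\<close>, and by
  Hurwitz' theorem they cannot appear inside the half plane; so there are none for any \<open>s > C\<close>,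
  which is the bound on \<open>Im \<tau>\<close>.

  The symbol \<open>\<sigma>(t, \<zeta>)\<close> is then entire in \<open>\<zeta>\<close> with growth \<open>exp (C\<^sub>0 t (1 + |Im \<zeta>|))\<close>, while the
  Fourier--Laplace transform of \<open>g\<close> is bounded by \<open>exp (K |Im \<zeta>|\<^sup>2 - e |\<zeta>|\<^sup>2)\<close>. Up to a phase the
  matrix coefficient for \<open>z = (x, \<xi>)\<close> and \<open>w = (u, v)\<close> is the integral of
  \<open>\<sigma>(t, \<omega>) \<g>(\<omega> - \<xi>) cnj \<g>(\<omega> - v) exp (2 \<pi> \<i> (u - x) \<bullet> \<omega>)\<close>, \<open>\<g>\<close> being the transform of \<open>g\<close>.
  Shifting \<open>\<omega>\<close> by \<open>\<i> \<delta> (u - x)\<close> gains \<open>exp (- 2 \<pi> \<delta> |u - x|\<^sup>2)\<close> and costs only \<open>O(\<delta>\<^sup>2 |u - x|\<^sup>2)\<close>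
  in the exponent, so a small \<open>\<delta>\<close> gives decay in \<open>u - x\<close>; the two Gaussians give decay
  in \<open>v - \<xi>\<close>.\<close>


section \<open>Zeros of hyperbolic symbols\<close>

lemma multi_deg_case_option: "multi_deg (case_option n \<alpha>) = n + multi_deg \<alpha>"
  by (simp add: multi_deg_def UNIV_option_conv sum.reindex)

lemma lookup_symbol_cpoly:
  "Poly_Mapping.lookup (symbol_cpoly m a) \<beta> =
     (\<i> ^ m when case_option m (\<lambda>_. 0) = \<beta>) +
     (\<Sum>k=1..m. \<Sum>\<alpha>\<in>Poly_Mapping.keys (a k).
        (Poly_Mapping.lookup (a k) \<alpha> * \<i> ^ (m - k) when case_option (m - k) \<alpha> = \<beta>))"
  by (simp add: symbol_cpoly_def lookup_add lookup_single lookup_sum)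

text \<open>Since the time direction is non-characteristic, some monomial of top degree is a pure
  power of \<tau>. No exponent of \<tau> exceeds \<open>m\<close>, so the whole symbol has degree at
  most \<open>m\<close>, and a monomial \<alpha> of \<open>a k\<close> enters it with total degree
  \<open>m - k + multi_deg \<alpha>\<close>.\<close>

lemma hyperbolic_degree:
  fixes a :: "nat \<Rightarrow> 'd::finite cpoly"
  assumes hyp: "hyperbolic m a" and k: "k \<in> {1..m}" and \<alpha>: "\<alpha> \<in> Poly_Mapping.keys (a k)"
  shows "multi_deg \<alpha> \<le> k"
proof -
  let ?p = "symbol_cpoly m a"
  have case_option_eq: "case_option i \<gamma> = case_option i' \<gamma>' \<longleftrightarrow> i = i' \<and> \<gamma> = \<gamma>'"
    for i i' and \<gamma> \<gamma>' :: "'d \<Rightarrow> nat"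
    by (auto simp: fun_eq_iff split: option.splits)
  have None_le: "\<beta> None \<le> m" if "\<beta> \<in> Poly_Mapping.keys ?p" for \<beta>
  proof (rule ccontr)
    assume "\<not> ?thesis"
    then have "Poly_Mapping.lookup ?p \<beta> = 0"
      unfolding lookup_symbol_cpoly by (auto intro!: sum.neutral simp: when_def)
    with that show False by (simp add: in_keys_iff)
  qed
  have "principal_eval ?p time_direction \<noteq> 0"
    using hyp by (simp add: hyperbolic_def)
  then obtain \<beta> where \<beta>: "\<beta> \<in> Poly_Mapping.keys ?p" "multi_deg \<beta> = cpoly_degree ?p"
      "multi_power (time_direction :: complex ^ 'd option) \<beta> \<noteq> 0"
    unfolding principal_eval_def by (rule sum.not_neutral_contains_not_neutral) auto
  have "\<beta> (Some j) = 0" for j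
    using \<beta>(3) by (auto simp: multi_power_def time_direction_def UNIV_option_conv prod.reindex)
  then have "multi_deg \<beta> = \<beta> None"
    by (simp add: multi_deg_def UNIV_option_conv sum.reindex)
  with None_le[OF \<beta>(1)] \<beta>(2) have deg: "cpoly_degree ?p \<le> m" by simp
  let ?\<gamma> = "case_option (m - k) \<alpha>"
  \<comment> \<open>No cancellation can occur: the exponent of \<tau> determines \<open>k\<close>,
    and \<open>k \<ge> 1\<close> separates the monomial from the leading term.\<close>
  have "Poly_Mapping.lookup ?p ?\<gamma> = (\<Sum>k'=1..m. if k' = k then Poly_Mapping.lookup (a k) \<alpha> * \<i> ^ (m - k) else 0)"
  proof -
    have "(\<Sum>\<alpha>'\<in>Poly_Mapping.keys (a k').
            (Poly_Mapping.lookup (a k') \<alpha>' * \<i> ^ (m - k') when case_option (m - k') \<alpha>' = ?\<gamma>))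
        = (if k' = k then Poly_Mapping.lookup (a k) \<alpha> * \<i> ^ (m - k) else 0)" if "k' \<in> {1..m}" for k'
    proof (cases "k' = k")
      case True
      then show ?thesis
        using \<alpha> by (simp add: case_option_eq when_def)
    next
      case False
      with that k have "m - k' \<noteq> m - k" by auto
      with False show ?thesis by (simp add: case_option_eq)
    qed
    moreover have "m \<noteq> m - k" using k by auto
    ultimately show ?thesis
      unfolding lookup_symbol_cpoly by (simp add: case_option_eq)
  qed
  also have "\<dots> \<noteq> 0"
    using k \<alpha> by (simp add: in_keys_iff)
  finally have "?\<gamma> \<in> Poly_Mapping.keys ?p" by (simp add: in_keys_iff)
  then have "multi_deg ?\<gamma> \<le> cpoly_degree ?p"
    unfolding cpoly_degree_def by (intro Max_ge) auto
  with deg k show ?thesis by (simp add: multi_deg_case_option)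
qed

lemma norm_multi_power_le:
  fixes z :: "complex ^ 'd::finite"
  shows "norm (multi_power z \<alpha>) \<le> (1 + norm z) ^ multi_deg \<alpha>"
proof -
  have "norm (multi_power z \<alpha>) = (\<Prod>j\<in>UNIV. norm (z $ j) ^ \<alpha> j)"
    by (simp add: multi_power_def prod_norm[symmetric] norm_power)
  also have "\<dots> \<le> (\<Prod>j\<in>UNIV. (1 + norm z) ^ \<alpha> j)"
    by (intro prod_mono conjI power_mono)
       (auto intro: order.trans[OF Finite_Cartesian_Product.norm_nth_le])
  finally show ?thesis by (simp add: multi_deg_def power_sum)
qed

lemma norm_cpoly_eval_le:
  fixes p :: "'d::finite cpoly"
  assumes "\<And>\<alpha>. \<alpha> \<in> Poly_Mapping.keys p \<Longrightarrow> multi_deg \<alpha> \<le> k"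
  shows "norm (cpoly_eval p z) \<le> (\<Sum>\<alpha>\<in>Poly_Mapping.keys p. norm (Poly_Mapping.lookup p \<alpha>)) * (1 + norm z) ^ k"
proof -
  have "norm (cpoly_eval p z) \<le>
      (\<Sum>\<alpha>\<in>Poly_Mapping.keys p. norm (Poly_Mapping.lookup p \<alpha>) * norm (multi_power z \<alpha>))"
    unfolding cpoly_eval_def norm_mult[symmetric] by (rule norm_sum)
  also have "\<dots> \<le> (\<Sum>\<alpha>\<in>Poly_Mapping.keys p. norm (Poly_Mapping.lookup p \<alpha>) * (1 + norm z) ^ k)"
    by (intro sum_mono mult_left_mono order.trans[OF norm_multi_power_le] power_increasing assms) auto
  finally show ?thesis by (simp add: sum_distrib_right)
qed

text \<open>Cauchy's root bound in homogeneous form. With \<open>r = 1 + norm \<zeta>\<close> the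
  \<open>k\<close>-th coefficient is at most \<open>b k * r ^ k\<close>, so for
  \<open>norm s > B * r\<close> the lower-order terms sum to at most
  \<open>(B - 1) * r * norm s ^ (m - 1)\<close>, too little to cancel \<open>s ^ m\<close>.\<close>

lemma hyperbolic_root_bound:
  fixes a :: "nat \<Rightarrow> 'd::finite cpoly"
  assumes m: "m \<ge> 1" and hyp: "hyperbolic m a"
  obtains A where "A \<ge> 1" "\<And>s \<zeta>. op_symbol m a s \<zeta> = 0 \<Longrightarrow> norm s \<le> A * (1 + norm \<zeta>)"
proof -
  define b where "b k = (\<Sum>\<alpha>\<in>Poly_Mapping.keys (a k). norm (Poly_Mapping.lookup (a k) \<alpha>))" for k
  define B where "B = 1 + (\<Sum>k=1..m. b k)"
  have b: "b k \<ge> 0" for k by (simp add: b_def sum_nonneg)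
  then have B: "B \<ge> 1" by (simp add: B_def sum_nonneg)
  have "norm s \<le> B * (1 + norm \<zeta>)" if root: "op_symbol m a s \<zeta> = 0" for s \<zeta>
  proof (rule ccontr)
    define r where "r = 1 + norm \<zeta>"
    assume "\<not> ?thesis"
    then have s: "B * r < norm s" by (simp add: r_def)
    have r: "r \<ge> 1" by (simp add: r_def)
    have "1 * r \<le> B * r" using B r by (intro mult_right_mono) auto
    with s have rs: "r \<le> norm s" by simp
    have "s ^ m = - (\<Sum>k=1..m. cpoly_eval (a k) \<zeta> * s ^ (m - k))"
      using root by (simp add: op_symbol_def add_eq_0_iff2)
    then have "norm s ^ m = norm (\<Sum>k=1..m. cpoly_eval (a k) \<zeta> * s ^ (m - k))"
      by (metis norm_minus_cancel norm_power)
    also have "\<dots> \<le> (\<Sum>k=1..m. norm (cpoly_eval (a k) \<zeta> * s ^ (m - k)))"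
      by (rule norm_sum)
    also have "\<dots> \<le> (\<Sum>k=1..m. b k * (r * norm s ^ (m - 1)))"
    proof (rule sum_mono)
      fix k assume k: "k \<in> {1..m}"
      have "norm (cpoly_eval (a k) \<zeta> * s ^ (m - k)) \<le> b k * r ^ k * norm s ^ (m - k)"
        unfolding norm_mult norm_power b_def r_def
        by (intro mult_right_mono norm_cpoly_eval_le hyperbolic_degree[OF hyp k]) auto
      also have "r ^ k = r * r ^ (k - 1)" using k by (cases k) auto
      also have "b k * (r * r ^ (k - 1)) * norm s ^ (m - k) \<le> b k * (r * norm s ^ (k - 1)) * norm s ^ (m - k)"
        using b r rs by (intro mult_right_mono mult_left_mono power_mono) auto
      also have "\<dots> = b k * (r * norm s ^ (m - 1))"
        using k by (simp add: power_add[symmetric])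
      finally show "norm (cpoly_eval (a k) \<zeta> * s ^ (m - k)) \<le> b k * (r * norm s ^ (m - 1))" .
    qed
    also have "\<dots> = (B - 1) * r * norm s ^ (m - 1)"
      by (simp add: B_def sum_distrib_right mult.assoc)
    also have "\<dots> < norm s * norm s ^ (m - 1)"
      using s r rs by (intro mult_strict_right_mono) (auto simp: algebra_simps intro!: zero_less_power)
    also have "\<dots> = norm s ^ m" using m by (cases m) auto
    finally show False by simp
  qed
  with B show thesis by (rule that)
qed

text \<open>Functions of complex frequencies are restricted to complexified real lines, where
  holomorphy in the single variable \<open>w\<close> suffices. Real \<open>w\<close> gives real
  frequencies.\<close>

definition complex_line :: "real ^ 'd \<Rightarrow> real ^ 'd \<Rightarrow> complex \<Rightarrow> complex ^ 'd::finite" where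
  "complex_line \<xi> \<eta> w = (\<chi> j. of_real (\<xi> $ j) + w * of_real (\<eta> $ j))"

lemma complex_line_of_real: "complex_line \<xi> \<eta> (of_real r) = complex_vec (\<xi> + r *\<^sub>R \<eta>)"
  by (simp add: complex_line_def complex_vec_def)

lemma Im_vec_complex_line: "Im_vec (complex_line \<xi> \<eta> w) = Im w *\<^sub>R \<eta>"
  by (simp add: Im_vec_def complex_line_def vec_eq_iff)

lemma norm_complex_vec: "norm (complex_vec \<xi>) = norm \<xi>"
  by (simp add: norm_vec_def complex_vec_def)

lemma norm_complex_line_le:
  "norm (complex_line \<xi> \<eta> w) \<le> norm \<xi> + norm w * norm \<eta>"
proof -
  have "complex_line \<xi> \<eta> w = complex_vec \<xi> + (\<chi> j. w * complex_vec \<eta> $ j)"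
    by (simp add: complex_line_def complex_vec_def vec_eq_iff)
  moreover have "norm (\<chi> j. w * complex_vec \<eta> $ j) = norm w * norm \<eta>"
    by (simp add: norm_vec_def L2_set_right_distrib norm_mult complex_vec_def)
  ultimately show ?thesis
    by (metis norm_complex_vec norm_triangle_ineq)
qed

lemma complex_line_continuous_on [continuous_intros]:
  "continuous_on S f \<Longrightarrow> continuous_on S (\<lambda>x. complex_line \<xi> \<eta> (f x))"
  unfolding complex_line_def by (intro continuous_on_vec_lambda continuous_intros)

lemma complex_line_nth_holomorphic_on [holomorphic_intros]:
  "f holomorphic_on S \<Longrightarrow> (\<lambda>w. complex_line \<xi> \<eta> (f w) $ j) holomorphic_on S"
  unfolding complex_line_def by (simp, intro holomorphic_intros)

lemma cpoly_eval_continuous_on [continuous_intros]: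
  fixes f :: "'a::topological_space \<Rightarrow> complex ^ 'd::finite"
  assumes "continuous_on S f"
  shows "continuous_on S (\<lambda>x. cpoly_eval p (f x))"
  unfolding cpoly_eval_def multi_power_def by (intro continuous_intros assms)

lemma cpoly_eval_holomorphic_on [holomorphic_intros]:
  fixes f :: "complex \<Rightarrow> complex ^ 'd::finite"
  assumes "\<And>j. (\<lambda>x. f x $ j) holomorphic_on S"
  shows "(\<lambda>x. cpoly_eval p (f x)) holomorphic_on S"
  unfolding cpoly_eval_def multi_power_def by (intro holomorphic_intros assms)

section \<open>A zero-free half plane\<close>

lemma closedin_top_of_set_sequentialI:
  fixes T U :: "'a::metric_space set"
  assumes "T \<subseteq> U" "\<And>f l. \<lbrakk>\<And>n. f n \<in> T; f \<longlonglongrightarrow> l; l \<in> U\<rbrakk> \<Longrightarrow> l \<in> T"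
  shows "closedin (top_of_set U) T"
  unfolding closedin_limpt using assms by (auto simp: islimpt_sequential)

text \<open>For fixed \<open>x\<close>, \<xi> and \<eta>, the set \<open>T\<close> of those
  \<open>s > C\<close> that admit a zero \<open>w\<close> in the open lower half plane is both open
  and closed in the connected half-line \<open>{C<..}\<close> and misses large \<open>s\<close>, so
  it is empty.\<close>

lemma hyperbolic_lower_half_plane:
  fixes a :: "nat \<Rightarrow> 'd::finite cpoly"
  assumes m: "m \<ge> 1" and hyp: "hyperbolic m a"
  obtains C L :: real where "C > 0" "L > 0"
    "\<And>s x \<xi> \<eta> w. \<lbrakk>norm \<eta> \<le> 1; C < s; Im w < 0\<rbrakk> \<Longrightarrow>
       op_symbol m a (Complex s x + \<i> * L * w) (complex_line \<xi> \<eta> w) \<noteq> 0"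
proof -
  obtain A where A: "A \<ge> 1" "\<And>s \<zeta>. op_symbol m a s \<zeta> = 0 \<Longrightarrow> norm s \<le> A * (1 + norm \<zeta>)"
    using hyperbolic_root_bound[OF m hyp] by blast
  obtain C where C: "C > 0"
    "\<And>\<tau> \<xi>. op_symbol m a (\<i> * \<tau>) (complex_vec \<xi>) = 0 \<Longrightarrow> Im \<tau> \<ge> - C"
    using hyp unfolding hyperbolic_def by blast
  \<comment> \<open>\<open>L - A \<ge> 1\<close> confines the zeros \<open>w\<close> for bounded
    \<open>s\<close>; \<open>L \<ge> 2 * A\<close> excludes zeros in the lower half plane when
    \<open>s\<close> is large.\<close>
  define L where "L = 2 * A + 1"
  have L: "L > 0" using A(1) by (simp add: L_def)
  have "op_symbol m a (Complex s x + \<i> * L * w) (complex_line \<xi> \<eta> w) \<noteq> 0"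
    if \<eta>: "norm \<eta> \<le> 1" and s: "C < s" and w: "Im w < 0" for s x \<xi> \<eta> w
  proof -
    define G where "G s w = op_symbol m a (Complex s x + \<i> * L * w) (complex_line \<xi> \<eta> w)" for s w
    define R where "R = A * (1 + norm \<xi>) + \<bar>x\<bar>"
    have root: "norm (Complex s x + \<i> * L * w) \<le> A * (1 + norm \<xi>) + A * norm w" if "G s w = 0" for s w
    proof -
      have "norm (complex_line \<xi> \<eta> w) \<le> norm \<xi> + norm w * 1"
        by (rule order.trans[OF norm_complex_line_le]) (intro add_left_mono mult_left_mono \<eta>, auto)
      then have "A * (1 + norm (complex_line \<xi> \<eta> w)) \<le> A * (1 + (norm \<xi> + norm w))"
        using A(1) by (intro mult_left_mono) auto
      with A(2)[OF that[unfolded G_def]] show ?thesis by (simp add: algebra_simps)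
    qed
    have root_bound: "norm w \<le> \<bar>s\<bar> + R" if "G s w = 0" for s w
    proof -
      have "norm (\<i> * L * w) \<le> norm (Complex s x + \<i> * L * w) + norm (Complex s x)"
        by (metis add.commute add_diff_cancel_left' norm_triangle_ineq4)
      also have "norm (Complex s x) \<le> \<bar>s\<bar> + \<bar>x\<bar>"
        using cmod_le[of "Complex s x"] by simp
      finally have "L * norm w \<le> A * norm w + \<bar>s\<bar> + R"
        using root[OF that] L by (simp add: norm_mult R_def)
      moreover have "(A + 1) * norm w \<ge> 1 * norm w"
        using A(1) by (intro mult_right_mono) auto
      ultimately show ?thesis by (simp add: L_def algebra_simps)
    qed
    \<comment> \<open>For \<open>Im w < 0\<close> the real part of \<open>u\<close> is
      \<open>s + L * \<bar>Im w\<bar>\<close>. Adding the bounds for the real and imaginary parts of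
      \<open>u\<close> makes \<open>L * norm w\<close> dominate the term
      \<open>2 * A * norm w\<close> that comes from twice the root bound.\<close>
    have large: "s \<le> 2 * R" if "G s w = 0" "Im w < 0" for s w
    proof -
      define u where "u = Complex s x + \<i> * L * w"
      have "s - L * Im w \<le> norm u" "\<bar>x + L * Re w\<bar> \<le> norm u"
        using abs_Re_le_cmod[of u] abs_Im_le_cmod[of u] by (auto simp: u_def)
      moreover have "L * \<bar>Re w\<bar> \<le> \<bar>x + L * Re w\<bar> + \<bar>x\<bar>"
        using abs_triangle_ineq4[of "x + L * Re w" x] L by (simp add: abs_mult)
      moreover have "L * norm w \<le> L * (\<bar>Re w\<bar> + \<bar>Im w\<bar>)"
        using L cmod_le[of w] by (intro mult_left_mono) auto
      moreover have "L * \<bar>Im w\<bar> = - (L * Im w)" using that(2) by simp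
      moreover have "2 * A * norm w \<le> L * norm w"
        by (intro mult_right_mono) (auto simp: L_def)
      ultimately show ?thesis
        using root[OF that(1)] unfolding u_def[symmetric] R_def by (simp add: distrib_left)
    qed
    \<comment> \<open>For real \<open>w\<close> the frequency is real, and the time frequency
      \<open>Complex x (- s) + L * w\<close> has imaginary part \<open>- s < - C\<close>, which
      hyperbolicity excludes.\<close>
    have real_nz: "G s w \<noteq> 0" if "C < s" "Im w = 0" for s w
    proof
      assume *: "G s w = 0"
      have w: "w = of_real (Re w)" using that(2) by (simp add: complex_eq_iff)
      have "Complex s x + \<i> * L * w = \<i> * (Complex x (- s) + L * w)"
        by (simp add: complex_eq_iff)
      with * have "op_symbol m a (\<i> * (Complex x (- s) + L * w)) (complex_vec (\<xi> + Re w *\<^sub>R \<eta>)) = 0"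
        unfolding G_def by (metis complex_line_of_real w)
      from C(2)[OF this] that show False by simp
    qed
    define H where "H = {w. Im w < 0}"
    have H: "open H" "convex H" by (auto simp: H_def open_halfspace_Im_lt convex_halfspace_Im_lt)
    have cont: "continuous_on UNIV (\<lambda>(s, w). G s w)"
      unfolding G_def op_symbol_def case_prod_unfold Complex_eq
      by (intro continuous_intros)
    have holo: "G s holomorphic_on H" for s
      unfolding G_def op_symbol_def
      by (intro holomorphic_intros)
    define T where "T = {s. C < s \<and> (\<exists>w. Im w < 0 \<and> G s w = 0)}"
    \<comment> \<open>Zeros belonging to a convergent sequence of values of \<open>s\<close> stay
      bounded, so a subsequence converges to a zero in the closed half plane; \<open>real_nz\<close>
      keeps the limit off the boundary.\<close>
    have closed: "closedin (top_of_set {C<..}) T"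
    proof (rule closedin_top_of_set_sequentialI)
      show "T \<subseteq> {C<..}" by (auto simp: T_def)
    next
      fix f l assume f: "\<And>n. f n \<in> T" "f \<longlonglongrightarrow> l" and "l \<in> {C<..}"
      then have l: "l > C" by simp
      obtain g where g: "\<And>n. Im (g n) < 0" "\<And>n. G (f n) (g n) = 0"
        using f(1) unfolding T_def mem_Collect_eq by metis
      obtain B where B: "\<And>n. \<bar>f n\<bar> \<le> B"
        using f(2) convergent_imp_Bseq[of f] by (auto simp: convergent_def Bseq_def)
      have "g n \<in> cball 0 (B + R)" for n
        using root_bound[OF g(2)[of n]] B[of n] by simp
      then obtain l' r where r: "strict_mono r" "(g \<circ> r) \<longlonglongrightarrow> l'"
        using compact_cball[of 0 "B + R"] unfolding compact_def by metis
      have "(\<lambda>n. ((f \<circ> r) n, (g \<circ> r) n)) \<longlonglongrightarrow> (l, l')"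
        by (intro tendsto_Pair LIMSEQ_subseq_LIMSEQ r f(2))
      from continuous_on_tendsto_compose[OF cont this] have "G l l' = 0"
        using g(2) by (simp add: LIMSEQ_const_iff)
      moreover have "Im l' \<le> 0"
        using tendsto_Im[OF r(2)] g(1) by (intro LIMSEQ_le_const2[of "\<lambda>n. Im ((g \<circ> r) n)"]) (auto intro: less_imp_le)
      ultimately show "l \<in> T"
        using real_nz[OF l, of l'] l unfolding T_def by force
    qed
    \<comment> \<open>Openness of \<open>T\<close>: the functions \<open>G (f n)\<close> converge to
      \<open>G l\<close> locally uniformly and have no zeros in \<open>H\<close>, so by Hurwitz'
      theorem the nonconstant limit has none.\<close>
    have "closedin (top_of_set {C<..}) ({C<..} - T)"
    proof (rule closedin_top_of_set_sequentialI)
      fix f l assume "\<And>n. f n \<in> {C<..} - T" "f \<longlonglongrightarrow> l" "l \<in> {C<..}"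
      then have f: "\<And>n. f n > C" "\<And>n. f n \<notin> T" "f \<longlonglongrightarrow> l" "l > C" by auto
      have "G l w \<noteq> 0" if "w \<in> H" for w
      proof
        assume G0: "G l w = 0"
        have "G l w \<noteq> 0"
        proof (rule Hurwitz_no_zeros[OF H(1) convex_connected[OF H(2)] _ _ _ _ _ that, where \<F> = "\<lambda>n. G (f n)"])
          show "uniform_limit K (\<lambda>n. G (f n)) (G l) sequentially" if "compact K" "K \<subseteq> H" for K
          proof (rule uniform_limitI)
            fix e :: real assume e: "e > 0"
            have "continuous_on (UNIV \<times> K) (\<lambda>(s, w). G s w)"
              by (rule continuous_on_subset[OF cont]) auto
            from continuous_on_prod_compactE[OF this \<open>compact K\<close> UNIV_I half_gt_zero[OF e], of l]
            obtain X where X: "l \<in> X" "open X"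
              "\<forall>s\<in>X \<inter> UNIV. \<forall>w\<in>K. dist (G s w) (G l w) \<le> e / 2"
              by (metis case_prod_conv)
            have "\<forall>\<^sub>F n in sequentially. f n \<in> X"
              by (rule topological_tendstoD[OF f(3) X(2,1)])
            then show "\<forall>\<^sub>F n in sequentially. \<forall>w\<in>K. dist (G (f n) w) (G l w) < e"
            proof eventually_elim
              case (elim n)
              show ?case
              proof
                fix w assume "w \<in> K"
                with X(3) elim have "dist (G (f n) w) (G l w) \<le> e / 2" by blast
                with e show "dist (G (f n) w) (G l w) < e" by simp
              qed
            qed
          qed
          \<comment> \<open>If constant, \<open>G l\<close> would vanish on all of \<open>H\<close>
            because of its zero at \<open>w\<close>; the point \<open>v\<close> just beyond the
            radius of \<open>root_bound\<close> contradicts this.\<close>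
          show "\<not> G l constant_on H"
          proof
            assume "G l constant_on H"
            then obtain c where c: "\<And>v. v \<in> H \<Longrightarrow> G l v = c" by (auto simp: constant_on_def)
            define v where "v = Complex 0 (- (\<bar>l\<bar> + R + 1))"
            have R: "R \<ge> 0" using A(1) by (simp add: R_def)
            then have v: "v \<in> H" "norm v = \<bar>l\<bar> + R + 1" by (auto simp: H_def v_def cmod_def)
            have "G l v = 0" using c[OF v(1)] c[OF that] G0 by simp
            from root_bound[OF this] v(2) show False by simp
          qed
          show "G (f n) v \<noteq> 0" if "v \<in> H" for n v
            using f(1)[of n] f(2)[of n] that by (auto simp: T_def H_def)
        qed (rule holo)+
        with G0 show False by simp
      qed
      with f(4) show "l \<in> {C<..} - T" by (auto simp: T_def H_def)
    qed auto
    then have "openin (top_of_set {C<..}) T"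
      by (simp add: openin_closedin_eq T_def subset_eq)
    with closed have "T = {} \<or> T = {C<..}"
      using connected_clopen[of "{C<..}"] connected_Ioi by blast
    moreover have "max (2 * R + 1) (C + 1) \<notin> T"
      using large by (force simp: T_def)
    ultimately have "T = {}" by auto
    with s w show ?thesis unfolding T_def G_def by blast
  qed
  with C(1) L show thesis by (rule that)
qed

text \<open>Every \<zeta> is the point \<open>w = - \<i> * v\<close> on a complexified line with
  direction \<open>- Im_vec \<zeta> / v\<close>, of norm at most 1. The tilt moves the real part of
  \<open>s\<close> by \<open>L * v\<close>, which is the loss linear in the imaginary part.\<close>

lemma hyperbolic_complex_bound:
  fixes a :: "nat \<Rightarrow> 'd::finite cpoly"
  assumes m: "m \<ge> 1" and hyp: "hyperbolic m a"
  obtains C :: real where "C > 0"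
    "\<And>s \<zeta>. op_symbol m a s \<zeta> = 0 \<Longrightarrow> Re s \<le> C * (1 + norm (Im_vec \<zeta>))"
proof -
  obtain C L :: real where CL: "C > 0" "L > 0"
    "\<And>s x \<xi> \<eta> w. \<lbrakk>norm \<eta> \<le> 1; C < s; Im w < 0\<rbrakk> \<Longrightarrow>
       op_symbol m a (Complex s x + \<i> * L * w) (complex_line \<xi> \<eta> w) \<noteq> (0 :: complex)"
    using hyperbolic_lower_half_plane[OF m hyp] by metis
  have "Re s \<le> (2 * C + L) * (1 + norm (Im_vec \<zeta>))" if "op_symbol m a s \<zeta> = 0" for s \<zeta>
  proof (rule ccontr)
    assume *: "\<not> ?thesis"
    \<comment> \<open>The summand \<open>C / L\<close> keeps \<open>v\<close> positive for real
      \<zeta> and costs only \<open>C\<close> in \<open>L * v\<close>; the constant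
      \<open>2 * C + L\<close> then leaves \<open>Re s - L * v > C\<close>.\<close>
    define v where "v = norm (Im_vec \<zeta>) + C / L"
    define \<eta> where "\<eta> = (- 1 / v) *\<^sub>R Im_vec \<zeta>"
    have v: "v > 0" using CL by (simp add: v_def add_nonneg_pos)
    have "norm \<eta> \<le> 1" using v CL by (simp add: \<eta>_def v_def)
    moreover have "C < Re s - L * v"
      using * CL by (simp add: v_def algebra_simps) (smt (verit) mult_nonneg_nonneg norm_ge_zero)
    moreover have "Im (Complex 0 (- v)) < 0" using v by simp
    ultimately have "op_symbol m a (Complex (Re s - L * v) (Im s) + \<i> * L * Complex 0 (- v))
        (complex_line (\<chi> j. Re (\<zeta> $ j)) \<eta> (Complex 0 (- v))) \<noteq> 0"
      by (rule CL(3))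
    moreover have "Complex (Re s - L * v) (Im s) + \<i> * L * Complex 0 (- v) = s"
      by (simp add: complex_eq_iff)
    moreover have "complex_line (\<chi> j. Re (\<zeta> $ j)) \<eta> (Complex 0 (- v)) = \<zeta>"
      using v by (simp add: complex_line_def vec_eq_iff complex_eq_iff \<eta>_def Im_vec_def)
    ultimately show False using that by simp
  qed
  moreover have "2 * C + L > 0" using CL by simp
  ultimately show thesis using that by blast
qed


section \<open>The propagator symbol at complex frequencies\<close>

text \<open>The power series of the existence proof as an explicit function of the coefficients
  \<open>c\<close>, so that complex frequencies can be inserted; \<open>k\<close> counts time
  derivatives.\<close>

definition fundamental_series :: "nat \<Rightarrow> (nat \<Rightarrow> complex) \<Rightarrow> nat \<Rightarrow> real \<Rightarrow> complex" where
  "fundamental_series m c k t = suminf (\<lambda>n. taylor_coeff m c (n + k) / fact n * of_real t ^ n)"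

text \<open>\<open>M\<close> is decoupled from \<open>c\<close> so that one majorant serves a
  bounded family of coefficients, as the Weierstrass test requires.\<close>

lemma norm_fundamental_series_term_le:
  assumes "1 + (\<Sum>k=1..m. norm (c k)) \<le> M"
  shows "norm (taylor_coeff m c (n + k) / fact n * z ^ n) \<le> M ^ k * ((M * norm z) ^ n /\<^sub>R fact n)"
proof -
  have "norm (taylor_coeff m c (n + k)) \<le> (1 + (\<Sum>k=1..m. norm (c k))) ^ (n + k)"
    by (rule taylor_coeff_bound)
  also have "\<dots> \<le> M ^ (n + k)"
    by (intro power_mono assms add_nonneg_nonneg sum_nonneg) auto
  finally have "norm (taylor_coeff m c (n + k)) * (norm z ^ n / fact n) \<le> M ^ (n + k) * (norm z ^ n / fact n)"
    by (rule mult_right_mono) auto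
  then show ?thesis
    by (simp add: norm_mult norm_divide norm_power power_add power_mult_distrib field_simps)
qed

lemma summable_fundamental_series: "summable (\<lambda>n. taylor_coeff m c (n + k) / fact n * z ^ n)"
  by (rule summable_comparison_test'[OF _ norm_fundamental_series_term_le[OF order.refl]])
     (intro summable_mult summable_exp_generic)

lemma fundamental_series_0: "fundamental_series m c k 0 = taylor_coeff m c k"
  using powser_zero[of "\<lambda>n. taylor_coeff m c (n + k) / fact n"] by (simp add: fundamental_series_def)

lemma has_vector_derivative_fundamental_series:
  "(fundamental_series m c k has_vector_derivative fundamental_series m c (Suc k) t) (at t within S)"
proof -
  have "diffs (\<lambda>n. taylor_coeff m c (n + k) / fact n) n = taylor_coeff m c (n + Suc k) / fact n" for n
    by (simp add: diffs_def divide_simps del: of_nat_Suc)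
  then have "((\<lambda>z. suminf (\<lambda>n. taylor_coeff m c (n + k) / fact n * z ^ n))
      has_field_derivative fundamental_series m c (Suc k) t) (at (complex_of_real t))"
    using termdiffs_strong_converges_everywhere
      [of "\<lambda>n. taylor_coeff m c (n + k) / fact n" "complex_of_real t", OF summable_fundamental_series]
    by (simp add: fundamental_series_def)
  then show ?thesis
    unfolding fundamental_series_def[of m c k, abs_def] by (rule has_vector_derivative_real_field)
qed

lemma fundamental_series_ode:
  assumes "m \<ge> 1"
  shows "fundamental_series m c m t + (\<Sum>k=1..m. c k * fundamental_series m c (m - k) t) = 0"
proof -
  let ?f = "\<lambda>k n. taylor_coeff m c (n + k) / fact n * complex_of_real t ^ n"
  have "(\<lambda>n. ?f m n + (\<Sum>k=1..m. c k * ?f (m - k) n)) sums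
      (fundamental_series m c m t + (\<Sum>k=1..m. c k * fundamental_series m c (m - k) t))"
    unfolding fundamental_series_def
    by (intro sums_add sums_sum sums_mult summable_sums summable_fundamental_series)
  moreover have "?f m n + (\<Sum>k=1..m. c k * ?f (m - k) n) = 0" for n
  proof -
    have "taylor_coeff m c (n + m) = - (\<Sum>k=1..m. c k * taylor_coeff m c (n + (m - k)))"
      using assms by (subst taylor_coeff.simps) (auto intro!: sum.cong)
    then show ?thesis
      by (simp add: sum_distrib_right sum_divide_distrib mult.assoc)
  qed
  ultimately show ?thesis
    by (simp add: sums_iff)
qed

lemma fundamental_solution_series:
  assumes "m \<ge> 1"
  shows "fundamental_solution m c (\<lambda>t. if t < 0 then 0 else fundamental_series m c 0 t)"
  unfolding fundamental_solution_def
  using assms has_vector_derivative_fundamental_series fundamental_series_ode[of m c]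
  by (intro conjI exI[of _ "fundamental_series m c"])
     (auto simp: fundamental_series_0 taylor_coeff.simps[of m c])

lemma propagator_symbol_eq_series:
  assumes "m \<ge> 1" "t \<ge> 0"
  shows "propagator_symbol m a t \<xi> =
    fundamental_series m (\<lambda>k. cpoly_eval (a k) (complex_vec \<xi>)) 0 t"
proof -
  let ?c = "\<lambda>k. cpoly_eval (a k) (complex_vec \<xi>)"
  have "(THE s. fundamental_solution m ?c s) = (\<lambda>t. if t < 0 then 0 else fundamental_series m ?c 0 t)"
    using assms by (intro the1_equality fundamental_solution_ex1 fundamental_solution_series)
  with assms(2) show ?thesis by (simp add: propagator_symbol_def)
qed

text \<open>The integrating factor \<open>exp (- s * r)\<close> leaves only the forcing term in the
  derivative. The mean value inequality bounds the increment, and \<open>Re s \<le> b\<close> makes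
  \<open>exp ((b - Re s) * r)\<close> largest at the end time.\<close>

lemma first_order_ode_bound:
  fixes v h :: "real \<Rightarrow> complex"
  assumes v: "\<And>r. (v has_vector_derivative s * v r + h r) (at r)"
    and h: "\<And>r. 0 \<le> r \<Longrightarrow> r \<le> t \<Longrightarrow> norm (h r) \<le> K * exp (b * r)"
    and "Re s \<le> b" "t \<ge> 0" "K \<ge> 0"
  shows "norm (v t) \<le> (norm (v 0) + t * K) * exp (b * t)"
proof (cases "t = 0")
  case False
  define w where "w r = exp (- s * of_real r) * v r" for r
  have w: "(w has_vector_derivative exp (- s * of_real r) * h r) (at r)" for r
  proof -
    have "((\<lambda>r. exp (- s * of_real r)) has_vector_derivative (- s * exp (- s * of_real r))) (at r)"
      by (rule has_vector_derivative_real_field) (auto intro!: derivative_eq_intros)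
    from has_vector_derivative_mult[OF this v] show ?thesis
      unfolding w_def by (simp add: algebra_simps)
  qed
  have "\<exists>r\<in>{0<..<t}. norm (w t - w 0) \<le> norm ((t - 0) *\<^sub>R (exp (- s * of_real r) * h r))"
    using w False \<open>t \<ge> 0\<close> unfolding has_vector_derivative_def
    by (intro mvt_general continuous_at_imp_continuous_on)
       (auto intro: has_derivative_continuous)
  then obtain r where r: "0 < r" "r < t" "norm (w t - w 0) \<le> t * (exp (- Re s * r) * norm (h r))"
    using \<open>t \<ge> 0\<close> by (auto simp: norm_mult)
  have "exp (- Re s * r) * norm (h r) \<le> exp (- Re s * r) * (K * exp (b * r))"
    using r h by (intro mult_left_mono) auto
  also have "\<dots> = K * exp ((b - Re s) * r)"
    by (simp add: left_diff_distrib exp_diff exp_minus field_simps)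
  also have "\<dots> \<le> K * exp ((b - Re s) * t)"
    using r assms by (intro mult_left_mono) (auto intro: mult_left_mono)
  finally have "norm (w t - w 0) \<le> t * (K * exp ((b - Re s) * t))"
    using r(3) \<open>t \<ge> 0\<close> by (meson mult_left_mono order.trans)
  then have "norm (w t) \<le> norm (v 0) + t * (K * exp ((b - Re s) * t))"
    using norm_triangle_ineq2[of "w t" "w 0"] by (simp add: w_def)
  then have "exp (Re s * t) * norm (w t) \<le> exp (Re s * t) * (norm (v 0) + t * (K * exp ((b - Re s) * t)))"
    by (intro mult_left_mono) auto
  also have "exp (Re s * t) * norm (w t) = norm (v t)"
    by (simp add: w_def norm_mult norm_exp_eq_Re mult.assoc[symmetric] exp_add[symmetric])
  also have "exp (Re s * t) * (norm (v 0) + t * (K * exp ((b - Re s) * t)))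
      = exp (Re s * t) * norm (v 0) + t * K * exp (b * t)"
    by (simp add: algebra_simps exp_add[symmetric])
  also have "\<dots> \<le> exp (b * t) * norm (v 0) + t * K * exp (b * t)"
    using assms by (intro add_right_mono mult_right_mono) (auto intro: mult_right_mono)
  finally show ?thesis by (simp add: algebra_simps)
qed auto

text \<open>Splitting the roots off one by one turns the equation of order \<open>m\<close> into a chain of \<open>m\<close>
  equations of first order, in which every root has real part at most \<open>b\<close>.\<close>

lemma norm_fundamental_series_le:
  assumes m: "m \<ge> 1" and t: "t \<ge> 0"
    and roots: "\<And>s. s ^ m + (\<Sum>k=1..m. c k * s ^ (m - k)) = 0 \<Longrightarrow> Re s \<le> b"
  shows "norm (fundamental_series m c 0 t) \<le> t ^ (m - 1) * exp (b * t)"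
proof -
  define u where "u = fundamental_series m c"
  define p where "p = monom 1 m + (\<Sum>k=1..m. monom (c k) (m - k))"
  \<comment> \<open>For \<open>degree q \<le> m\<close>, \<open>D q\<close> is the operator q(d/dt)
    applied to the solution; \<open>p\<close> is the characteristic polynomial, so the vanishing of
    \<open>D p\<close> is the equation itself.\<close>
  define D where "D q t = (\<Sum>i\<le>m. coeff q i * u i t)" for q t
  have u0: "u i 0 = (if Suc i = m then 1 else 0)" if "Suc i \<le> m" for i
    using that by (auto simp: u_def fundamental_series_0 taylor_coeff.simps)
  have poly_p: "poly p s = s ^ m + (\<Sum>k=1..m. c k * s ^ (m - k))" for s
    by (simp add: p_def poly_sum poly_monom)
  have coeff_sum: "coeff (\<Sum>k=1..m. monom (c k) (m - k)) i = 0" if "i \<ge> m" for i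
    using that m by (auto simp: coeff_sum intro!: sum.neutral)
  have coeff_p: "coeff p m = 1" "\<And>i. i > m \<Longrightarrow> coeff p i = 0"
    using coeff_sum by (auto simp: p_def)
  have "degree p = m"
    by (intro antisym degree_le le_degree) (use coeff_p in auto)
  then have p: "degree p = m" "lead_coeff p = 1" "p \<noteq> 0"
    using coeff_p(1) by auto
  have D_add: "D (q + r) x = D q x + D r x" for q r x
    by (simp add: D_def sum.distrib algebra_simps)
  have D_diff: "D (q - r) x = D q x - D r x" for q r x
    by (simp add: D_def sum_subtractf algebra_simps)
  have D_zero: "D 0 x = 0" for x
    by (simp add: D_def)
  have D_smult: "D (smult s q) x = s * D q x" for s q x
    by (simp add: D_def sum_distrib_left mult.assoc)
  have D_monom: "D (monom s i) x = s * u i x" if "i \<le> m" for s i x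
    using that by (simp add: D_def if_distrib[of "\<lambda>x. x * _"] cong: if_cong)
  have D_sum: "D (\<Sum>k\<in>A. f k) x = (\<Sum>k\<in>A. D (f k) x)" for A :: "nat set" and f x
    by (induction A rule: infinite_finite_induct) (simp_all add: D_add D_zero)
  have D_p: "D p x = 0" for x
    using fundamental_series_ode[OF m, of c x]
    by (simp add: p_def D_add D_sum D_monom u_def)
  \<comment> \<open>Multiplying \<open>q\<close> by the indeterminate X corresponds to d/dt, and
    \<open>[:-s, 1:]\<close> is X - s; \<open>degree q < m\<close> keeps the product within the
    truncation of \<open>D\<close>.\<close>
  have D_deriv: "(D q has_vector_derivative s * D q x + D (q * [:-s, 1:]) x) (at x)"
    if "degree q < m" for q s x
  proof -
    have "(\<Sum>i\<le>m. coeff q i * u (Suc i) x) = (\<Sum>i<m. coeff q i * u (Suc i) x)"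
      using that by (simp add: lessThan_Suc_atMost[symmetric] coeff_eq_0)
    also have "\<dots> = D (pCons 0 q) x"
      unfolding D_def by (simp add: sum.atMost_shift)
    also have "\<dots> = s * D q x + D (q * [:-s, 1:]) x"
      by (simp add: mult_pCons_right D_diff D_smult)
    finally have "(\<Sum>i\<le>m. coeff q i * u (Suc i) x) = s * D q x + D (q * [:-s, 1:]) x" .
    moreover have "((\<lambda>x. \<Sum>i\<le>m. coeff q i * u i x) has_vector_derivative
        (\<Sum>i\<le>m. coeff q i * u (Suc i) x)) (at x)"
      unfolding u_def
      by (intro has_vector_derivative_sum has_vector_derivative_mult_right has_vector_derivative_fundamental_series)
    ultimately show ?thesis
      by (simp add: D_def[of q, abs_def])
  qed
  \<comment> \<open>A root taken from the cofactor \<open>r\<close> is a root of \<open>p\<close>,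
    hence has real part at most \<open>b\<close>.\<close>
  have split: "\<exists>s r'. r = [:-s, 1:] * r' \<and> degree r' = n \<and> Re s \<le> b"
    if qr: "p = q * r" "degree r = Suc n" for q r n
  proof -
    obtain s where s: "poly r s = 0"
      using alg_closed_imp_poly_has_root[of r] qr by auto
    then obtain r' where r': "r = [:-s, 1:] * r'"
      by (auto simp: poly_eq_0_iff_dvd elim: dvdE)
    with qr(2) have "r' \<noteq> 0" by auto
    with qr(2) have "degree r' = n"
      unfolding r' by (subst (asm) degree_mult_eq) auto
    moreover have "poly p s = 0" using qr(1) s by simp
    ultimately show ?thesis using roots[of s] r' unfolding poly_p by blast
  qed
  have D_0: "D q 0 = coeff q (m - 1)" if "degree q < m" for q
  proof -
    have "D q 0 = (\<Sum>i\<le>m. if i = m - 1 then coeff q i else 0)"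
      unfolding D_def
    proof (rule sum.cong)
      fix i assume "i \<in> {..m}"
      then consider "i = m" | "Suc i \<le> m" by force
      then show "coeff q i * u i 0 = (if i = m - 1 then coeff q i else 0)"
        using that m u0[of i] by cases (auto simp: coeff_eq_0)
    qed simp
    then show ?thesis by simp
  qed
  \<comment> \<open>Induction over the degree of the remaining cofactor. With one root left,
    \<open>D q\<close> solves a homogeneous equation with initial value 1. Otherwise it starts at 0
    and is driven by \<open>D (q * [:-s, 1:])\<close>, already bounded, which adds one factor
    \<open>t\<close>. The case \<open>q = 1\<close> is the solution itself.\<close>
  have "norm (D q t) \<le> t ^ n * exp (b * t)"
    if "t \<ge> 0" "p = q * r" "lead_coeff q = 1" "degree r = Suc n" for n q r t
    using that
  proof (induction n arbitrary: q r t)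
    case (0 q r t)
    then obtain s r' where r': "r = [:-s, 1:] * r'" "degree r' = 0" "Re s \<le> b"
      using split by metis
    have "q \<noteq> 0" "r \<noteq> 0" using 0 p(3) by auto
    then have deg: "Suc (degree q) = m" using 0 p(1) by (simp add: degree_mult_eq)
    have "lead_coeff r' = 1"
      using p(2) 0 r'(1) by (simp only: lead_coeff_mult) simp
    with r'(2) have "r' = 1" by (auto elim!: degree_eq_zeroE simp: one_pCons)
    with 0 r' have "q * [:-s, 1:] = p" by simp
    with D_deriv[of q s] D_p deg
    have deriv: "(D q has_vector_derivative s * D q x + 0) (at x)" for x by force
    have "norm (D q t) \<le> (norm (D q 0) + t * 0) * exp (b * t)"
      by (rule first_order_ode_bound[OF deriv]) (use 0 r' in auto)
    moreover have "D q 0 = 1" using 0 deg by (subst D_0) auto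
    ultimately show ?case by simp
  next
    case (Suc n q r t)
    then obtain s r' where r': "r = [:-s, 1:] * r'" "degree r' = Suc n" "Re s \<le> b"
      using split by metis
    have "q \<noteq> 0" "r \<noteq> 0" using Suc.prems p(3) by auto
    then have deg: "degree q + Suc (Suc n) = m" using Suc.prems p(1) by (simp add: degree_mult_eq)
    have "norm (D (q * [:-s, 1:]) x) \<le> t ^ n * exp (b * x)" if "0 \<le> x" "x \<le> t" for x
    proof -
      have "norm (D (q * [:-s, 1:]) x) \<le> x ^ n * exp (b * x)"
      proof (rule Suc.IH[OF that(1) _ _ r'(2)])
        show "p = q * [:-s, 1:] * r'" using Suc.prems(2) r'(1) by (simp only: mult.assoc)
        show "lead_coeff (q * [:-s, 1:]) = 1" using Suc.prems(3) by (simp only: lead_coeff_mult) simp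
      qed
      also have "\<dots> \<le> t ^ n * exp (b * x)"
        using that by (intro mult_right_mono power_mono) auto
      finally show ?thesis .
    qed
    then have "norm (D q t) \<le> (norm (D q 0) + t * t ^ n) * exp (b * t)"
      using Suc.prems(1) r'(3) deg by (intro first_order_ode_bound[OF D_deriv]) auto
    moreover have "D q 0 = 0" using deg by (subst D_0) (auto simp: coeff_eq_0)
    ultimately show ?case by simp
  qed
  from this[of t 1 p "m - 1"] have "norm (D 1 t) \<le> t ^ (m - 1) * exp (b * t)"
    using m t p by auto
  moreover have "D 1 t = u 0 t"
    using D_monom[of 0 1 t] by (simp add: monom_0 one_pCons)
  ultimately show ?thesis by (simp add: u_def)
qed

section \<open>Holomorphic and measurable dependence on the coefficients\<close>

lemma taylor_coeff_holomorphic_on: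
  assumes "\<And>k. (\<lambda>w. c w k) holomorphic_on S"
  shows "(\<lambda>w. taylor_coeff m (c w) n) holomorphic_on S"
proof (induction n rule: less_induct)
  case (less n)
  show ?case
  proof (cases "Suc n \<le> m \<or> m = 0")
    case True
    then show ?thesis by (cases "Suc n < m") (auto simp: taylor_coeff.simps[of m _ n])
  next
    case False
    then show ?thesis
      by (subst taylor_coeff.simps) (auto intro!: holomorphic_intros assms less)
  qed
qed

text \<open>The partial sums are holomorphic. On a closed disc compactness bounds the coefficients
  uniformly, and the majorant by an exponential series gives uniform convergence.\<close>

lemma fundamental_series_holomorphic_on:
  assumes S: "open S" and c: "\<And>k. (\<lambda>w. c w k) holomorphic_on S"
  shows "(\<lambda>w. fundamental_series m (c w) 0 t) holomorphic_on S"
proof (rule holomorphic_uniform_sequence[OF S])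
  let ?f = "\<lambda>n w. taylor_coeff m (c w) (n + 0) / fact n * complex_of_real t ^ n"
  show "(\<lambda>w. \<Sum>i<n. ?f i w) holomorphic_on S" for n
    by (intro holomorphic_intros taylor_coeff_holomorphic_on c) auto
  fix x assume "x \<in> S"
  then obtain d where d: "d > 0" "cball x d \<subseteq> S"
    using S by (meson open_contains_cball)
  have "continuous_on (cball x d) (\<lambda>w. 1 + (\<Sum>k=1..m. norm (c w k)))"
    by (intro continuous_intros holomorphic_on_imp_continuous_on holomorphic_on_subset[OF c d(2)])
  then have "compact ((\<lambda>w. 1 + (\<Sum>k=1..m. norm (c w k))) ` cball x d)"
    by (rule compact_continuous_image) simp
  then obtain M where M: "\<And>w. w \<in> cball x d \<Longrightarrow> 1 + (\<Sum>k=1..m. norm (c w k)) \<le> M"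
    by (meson bounded_imp_bdd_above bdd_above.E compact_imp_bounded imageI)
  have "uniform_limit (cball x d) (\<lambda>n w. \<Sum>i<n. ?f i w) (\<lambda>w. suminf (\<lambda>i. ?f i w)) sequentially"
    by (rule Weierstrass_m_test[OF norm_fundamental_series_term_le[OF M]])
       (assumption, intro summable_mult summable_exp_generic)
  with d show "\<exists>d>0. cball x d \<subseteq> S \<and>
      uniform_limit (cball x d) (\<lambda>n w. \<Sum>i<n. ?f i w) (\<lambda>w. fundamental_series m (c w) 0 t) sequentially"
    unfolding fundamental_series_def by blast
qed

lemma taylor_coeff_measurable [measurable]:
  assumes [measurable]: "\<And>k. (\<lambda>x. c x k) \<in> borel_measurable M"
  shows "(\<lambda>x. taylor_coeff m (c x) n) \<in> borel_measurable M"
proof (induction n rule: less_induct)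
  case (less n)
  show ?case
  proof (cases "Suc n \<le> m \<or> m = 0")
    case True
    then show ?thesis by (cases "Suc n < m") (auto simp: taylor_coeff.simps[of m _ n])
  next
    case False
    have "(\<lambda>x. - (\<Sum>k=1..m. c x k * taylor_coeff m (c x) (n - k))) \<in> borel_measurable M"
      using less False by (intro borel_measurable_uminus borel_measurable_sum borel_measurable_times assms) auto
    with False show ?thesis
      by (subst taylor_coeff.simps) auto
  qed
qed

lemma fundamental_series_measurable [measurable]:
  assumes [measurable]: "\<And>k. (\<lambda>x. c x k) \<in> borel_measurable M"
  shows "(\<lambda>x. fundamental_series m (c x) n t) \<in> borel_measurable M"
  unfolding fundamental_series_def by measurable


section \<open>Gaussian estimates and integrals depending on a complex parameter\<close>

text \<open>Dividing the squared moments by \<open>fact n * (2 * B\<^sup>2) ^ n\<close> and summing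
  over \<open>n\<close> gives an exponential series on the left and a geometric series of ratio 1/2
  on the right. The claim is the square root of the resulting bound on
  \<open>a\<^sup>2 * exp y\<close>.\<close>

lemma gaussian_bound_of_moments:
  fixes x a M B :: real
  assumes "x \<ge> 0" "a \<ge> 0" "B > 0" and moments: "\<And>n. x ^ n * a \<le> M * B ^ n * sqrt (fact n)"
  shows "a \<le> sqrt 2 * M * exp (- (x\<^sup>2 / (4 * B\<^sup>2)))"
proof -
  define y where "y = x\<^sup>2 / (2 * B\<^sup>2)"
  have M: "M \<ge> 0" using moments[of 0] \<open>a \<ge> 0\<close> by simp
  have sums_a: "(\<lambda>n. a\<^sup>2 * (y ^ n /\<^sub>R fact n)) sums (a\<^sup>2 * exp y)"
    by (intro sums_mult exp_converges)
  have sums_M: "(\<lambda>n. M\<^sup>2 * (1 / 2) ^ n) sums (M\<^sup>2 * (1 / (1 - 1 / 2)))"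
    by (intro sums_mult geometric_sums) auto
  have "a\<^sup>2 * (y ^ n /\<^sub>R fact n) \<le> M\<^sup>2 * (1 / 2) ^ n" for n
  proof -
    have "(x ^ n * a)\<^sup>2 \<le> (M * B ^ n * sqrt (fact n))\<^sup>2"
      using assms by (intro power_mono moments) auto
    then have "(x\<^sup>2) ^ n * a\<^sup>2 \<le> M\<^sup>2 * (B\<^sup>2) ^ n * fact n"
      by (simp add: power_mult_distrib power_mult[symmetric] mult.commute)
    then show ?thesis
      using \<open>B > 0\<close> by (simp add: y_def power_divide power_mult_distrib field_simps)
  qed
  from sums_le[OF this sums_a sums_M] have "a\<^sup>2 * exp y \<le> M\<^sup>2 * 2"
    by simp
  then have "a\<^sup>2 \<le> 2 * M\<^sup>2 * exp (- y)"
    by (simp add: exp_minus field_simps)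
  also have "\<dots> = (sqrt 2 * M * exp (- (y / 2)))\<^sup>2"
    by (simp add: power_mult_distrib power2_eq_square[of "exp _"] exp_add[symmetric])
  finally have "a\<^sup>2 \<le> (sqrt 2 * M * exp (- (y / 2)))\<^sup>2" .
  moreover have "0 \<le> sqrt 2 * M * exp (- (y / 2))" using M by simp
  ultimately have "a \<le> sqrt 2 * M * exp (- (y / 2))" by (rule power2_le_imp_le)
  then show ?thesis by (simp add: y_def)
qed

text \<open>The Gaussian is a product over the coordinates, and each factor is a multiple of a
  normal density.\<close>

lemma integrable_gaussian:
  fixes e :: real
  assumes "e > 0"
  shows "integrable lborel (\<lambda>y::'a::euclidean_space. exp (- (e * (norm y)\<^sup>2)))"
proof -
  define \<sigma> where "\<sigma> = sqrt (1 / (2 * e))"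
  have \<sigma>: "\<sigma> > 0" "2 * \<sigma>\<^sup>2 = 1 / e" using assms by (auto simp: \<sigma>_def)
  have "integrable lborel (\<lambda>x. sqrt (2 * pi * \<sigma>\<^sup>2) * normal_density 0 \<sigma> x)"
    using \<sigma> by (intro integrable_mult_right) auto
  also have "(\<lambda>x. sqrt (2 * pi * \<sigma>\<^sup>2) * normal_density 0 \<sigma> x) = (\<lambda>x. exp (- (e * x\<^sup>2)))"
    using \<sigma> assms by (auto simp: normal_density_def fun_eq_iff)
  finally have *: "(\<integral>\<^sup>+x. ennreal (exp (- (e * x\<^sup>2))) \<partial>lborel) < \<infinity>"
    by (simp add: integrable_iff_bounded)
  have "(\<integral>\<^sup>+y. ennreal (exp (- (e * (norm (y::'a))\<^sup>2))) \<partial>lborel)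
      = (\<integral>\<^sup>+y. (\<Prod>b\<in>(Basis::'a set). ennreal (exp (- (e * (y \<bullet> b)\<^sup>2)))) \<partial>lborel)"
  proof (rule nn_integral_cong)
    fix y :: 'a
    have "(norm y)\<^sup>2 = (\<Sum>b\<in>Basis. (y \<bullet> b)\<^sup>2)"
      unfolding power2_norm_eq_inner by (subst euclidean_inner) (simp add: power2_eq_square)
    then have "exp (- (e * (norm y)\<^sup>2)) = (\<Prod>b\<in>Basis. exp (- (e * (y \<bullet> b)\<^sup>2)))"
      by (subst exp_sum[symmetric]) (simp_all add: sum_distrib_left sum_negf)
    then show "ennreal (exp (- (e * (norm y)\<^sup>2))) = (\<Prod>b\<in>(Basis::'a set). ennreal (exp (- (e * (y \<bullet> b)\<^sup>2))))"
      by (simp add: prod_ennreal)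
  qed
  also have "\<dots> = (\<Prod>b\<in>(Basis::'a set). \<integral>\<^sup>+x. ennreal (exp (- (e * x\<^sup>2))) \<partial>lborel)"
    by (rule nn_integral_lborel_prod) auto
  also have "\<dots> < \<infinity>"
    using * by (simp add: power_less_top_ennreal)
  finally show ?thesis by (simp add: integrable_iff_bounded)
qed

section \<open>Translation of integrals and holomorphic parameters\<close>

lemma integral_lborel_translation:
  fixes f :: "'a::euclidean_space \<Rightarrow> 'b::{banach, second_countable_topology}"
  assumes [measurable]: "f \<in> borel_measurable borel"
  shows "(\<integral>x. f (c + x) \<partial>lborel) = (\<integral>x. f x \<partial>lborel)"
proof -
  have "(\<integral>x. f x \<partial>distr lborel borel ((+) c)) = (\<integral>x. f (c + x) \<partial>lborel)"
    by (rule integral_distr) auto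
  then show ?thesis by (simp add: lborel_distr_plus)
qed

lemma integrable_lborel_translation:
  fixes f :: "'a::euclidean_space \<Rightarrow> 'b::{banach, second_countable_topology}"
  assumes "integrable lborel f"
  shows "integrable lborel (\<lambda>x. f (c + x))"
proof -
  have [measurable]: "f \<in> borel_measurable borel" using assms by auto
  have "integrable (distr lborel borel ((+) c)) f" using assms by (simp add: lborel_distr_plus)
  then show ?thesis by (subst (asm) integrable_distr_eq) auto
qed

text \<open>Differentiation under the integral sign. Cauchy's inequality turns the majorant
  \<open>B x\<close> of the functions into the majorant \<open>B x / r\<close> of their derivatives,
  hence of the difference quotients, and dominated convergence applies.\<close>

lemma holomorphic_on_lebesgue_integral:
  fixes f :: "complex \<Rightarrow> 'a \<Rightarrow> complex"
  assumes S: "open S" and holo: "\<And>x. x \<in> space M \<Longrightarrow> (\<lambda>w. f w x) holomorphic_on S"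
    and meas: "\<And>w. w \<in> S \<Longrightarrow> f w \<in> borel_measurable M"
    and B: "integrable M B" "\<And>w x. w \<in> S \<Longrightarrow> x \<in> space M \<Longrightarrow> norm (f w x) \<le> B x"
  shows "(\<lambda>w. \<integral>x. f w x \<partial>M) holomorphic_on S"
proof -
  have int: "integrable M (f w)" if "w \<in> S" for w
    using that B by (intro Bochner_Integration.integrable_bound[OF B(1) meas]) (auto intro!: AE_I2 order.trans[OF B(2)])
  have "\<exists>D. ((\<lambda>w. \<integral>x. f w x \<partial>M) has_field_derivative D) (at w)" if "w \<in> S" for w
  proof -
    obtain r' where "r' > 0" "cball w r' \<subseteq> S"
      using S \<open>w \<in> S\<close> open_contains_cball[of S] by auto
    \<comment> \<open>The double radius leaves a closed disc of radius \<open>r\<close> inside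
      \<open>S\<close> around every point of \<open>ball w r\<close>, as Cauchy's inequality
      needs.\<close>
    then obtain r where r: "r > 0" "cball w (2 * r) \<subseteq> S"
      by (intro that[of "r' / 2"]) auto
    have deriv_le: "norm (deriv (\<lambda>w. f w x) v) \<le> B x / r" if v: "v \<in> ball w r" and x: "x \<in> space M" for v x
    proof -
      have "cball v r \<subseteq> cball w (2 * r)"
        using v by (auto simp: cball_subset_cball_iff dist_commute)
      with r have sub: "cball v r \<subseteq> S" by auto
      have "norm ((deriv ^^ 1) (\<lambda>w. f w x) v) \<le> fact 1 * B x / r ^ 1"
      proof (rule Cauchy_inequality)
        show "(\<lambda>w. f w x) holomorphic_on ball v r"
          using sub by (intro holomorphic_on_subset[OF holo[OF x]]) auto
        show "continuous_on (cball v r) (\<lambda>w. f w x)"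
          by (intro holomorphic_on_imp_continuous_on holomorphic_on_subset[OF holo[OF x] sub])
        show "norm (f u x) \<le> B x" if "norm (v - u) = r" for u
          using sub that x by (intro B(2)) (auto simp: dist_norm)
      qed (use r in auto)
      then show ?thesis by simp
    qed
    have fd: "((\<lambda>w. f w x) has_field_derivative deriv (\<lambda>w. f w x) v) (at v)"
      if "v \<in> ball w r" "x \<in> space M" for v x
    proof (rule holomorphic_derivI[OF holo[OF that(2)] S])
      have "ball w r \<subseteq> cball w (2 * r)" using r by auto
      then show "v \<in> S" using r that by auto
    qed
    define D where "D = (\<integral>x. deriv (\<lambda>w. f w x) w \<partial>M)"
    have "((\<lambda>v. ((\<integral>x. f v x \<partial>M) - (\<integral>x. f w x \<partial>M)) / (v - w)) \<longlongrightarrow> D) (at w within ball w r)"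
      unfolding tendsto_at_iff_sequentially comp_def
    proof (intro allI impI)
      fix X assume X: "\<forall>i. X i \<in> ball w r - {w}" "X \<longlonglongrightarrow> w"
      then have X': "X i \<in> ball w r" "X i \<noteq> w" for i by auto
      have XS: "X i \<in> S" for i
      proof -
        have "ball w r \<subseteq> cball w (2 * r)" using r by auto
        then show ?thesis using r X'(1)[of i] by auto
      qed
      define q where "q i x = (f (X i) x - f w x) / (X i - w)" for i x
      have q_lim: "(\<lambda>i. q i x) \<longlonglongrightarrow> deriv (\<lambda>w. f w x) w" if "x \<in> space M" for x
      proof -
        have "((\<lambda>v. (f v x - f w x) / (v - w)) \<longlongrightarrow> deriv (\<lambda>w. f w x) w) (at w)"
          using fd[of w x] r that by (simp add: DERIV_def has_field_derivative_iff)
        then show ?thesis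
          unfolding q_def tendsto_at_iff_sequentially comp_def using X X' by blast
      qed
      have q_meas: "q i \<in> borel_measurable M" for i
        unfolding q_def by (intro borel_measurable_divide borel_measurable_diff meas XS that borel_measurable_const)
      have "(\<lambda>i. \<integral>x. q i x \<partial>M) \<longlonglongrightarrow> D"
        unfolding D_def
      proof (rule integral_dominated_convergence)
        show "(\<lambda>x. deriv (\<lambda>w. f w x) w) \<in> borel_measurable M"
          by (rule borel_measurable_LIMSEQ_metric[OF q_meas q_lim])
        show "integrable M (\<lambda>x. B x / r)" using B(1) by simp
        show "AE x in M. norm (q i x) \<le> B x / r" for i
        proof (rule AE_I2)
          fix x assume x: "x \<in> space M"
          have "norm (f (X i) x - f w x) \<le> B x / r * norm (X i - w)"
            by (rule field_differentiable_bound[of "ball w r" "\<lambda>w. f w x" "deriv (\<lambda>w. f w x)"])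
               (use fd deriv_le x X' r in \<open>auto intro: has_field_derivative_at_within\<close>)
          then show "norm (q i x) \<le> B x / r"
            using X'(2)[of i] by (simp add: q_def norm_divide divide_le_eq)
        qed
      qed (use q_lim q_meas in auto)
      moreover have "(\<integral>x. q i x \<partial>M) = ((\<integral>x. f (X i) x \<partial>M) - (\<integral>x. f w x \<partial>M)) / (X i - w)" for i
        unfolding q_def using int[OF XS[of i]] int[OF that] by simp
      ultimately show "(\<lambda>i. ((\<integral>x. f (X i) x \<partial>M) - (\<integral>x. f w x \<partial>M)) / (X i - w)) \<longlonglongrightarrow> D"
        by simp
    qed
    then have "((\<lambda>w. \<integral>x. f w x \<partial>M) has_field_derivative D) (at w within ball w r)"
      by (simp add: has_field_derivative_iff)
    then show ?thesis
      using r by (auto simp: at_within_open[of w "ball w r"])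
  qed
  with S show ?thesis by (simp add: holomorphic_on_open)
qed


section \<open>The Fourier--Laplace transform\<close>

text \<open>The exponent pairs \<open>y\<close> and \<zeta> bilinearly, without conjugation, which
  makes the kernel holomorphic in \<zeta>.\<close>

definition fourier_kernel :: "complex ^ 'd::finite \<Rightarrow> real ^ 'd \<Rightarrow> complex" where
  "fourier_kernel \<zeta> y = exp (- 2 * of_real pi * \<i> * (\<Sum>j\<in>UNIV. of_real (y $ j) * \<zeta> $ j))"

definition fourier_laplace :: "(real ^ 'd::finite \<Rightarrow> complex) \<Rightarrow> complex ^ 'd \<Rightarrow> complex" where
  "fourier_laplace f \<zeta> = (LINT y|lborel. f y * fourier_kernel \<zeta> y)"

lemma vec_nth_measurable [measurable]: "(\<lambda>x::real ^ 'd::finite. x $ j) \<in> borel_measurable borel"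
  by (intro borel_measurable_continuous_onI continuous_intros)

lemma fourier_kernel_complex_line:
  "fourier_kernel (complex_line \<omega> \<theta> w) y =
     exp (- 2 * of_real pi * \<i> * (of_real (y \<bullet> \<omega>) + w * of_real (y \<bullet> \<theta>)))"
  by (simp add: fourier_kernel_def complex_line_def inner_vec_def algebra_simps sum.distrib sum_distrib_left)

lemma fourier_kernel_measurable [measurable]: "fourier_kernel \<zeta> \<in> borel_measurable borel"
  unfolding fourier_kernel_def by measurable

lemma fourier_kernel_add: "fourier_kernel \<zeta> (x + y) = fourier_kernel \<zeta> x * fourier_kernel \<zeta> y"
  by (simp add: fourier_kernel_def exp_add[symmetric] sum.distrib algebra_simps)

lemma fourier_kernel_scaleR_axis: "fourier_kernel \<zeta> (s *\<^sub>R axis j 1) = exp (- 2 * of_real pi * \<i> * \<zeta> $ j * of_real s)"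
proof -
  have "(\<Sum>i\<in>UNIV. of_real ((s *\<^sub>R axis j 1) $ i) * \<zeta> $ i) = (\<Sum>i\<in>UNIV. if i = j then of_real s * \<zeta> $ j else 0)"
    by (intro sum.cong) (auto simp: axis_def)
  then show ?thesis by (simp add: fourier_kernel_def algebra_simps)
qed

lemma norm_fourier_kernel: "norm (fourier_kernel \<zeta> y) = exp (2 * pi * (y \<bullet> Im_vec \<zeta>))"
  by (simp add: fourier_kernel_def norm_exp_eq_Re inner_vec_def Im_vec_def)

text \<open>Half of the Gaussian absorbs the growth of the kernel: Cauchy-Schwarz and completing a
  square bound the exponent \<open>2 * pi * (y \<bullet> Im_vec \<zeta>)\<close>.\<close>

lemma norm_fourier_kernel_gaussian:
  assumes "e > 0"
  shows "exp (- (e * (norm y)\<^sup>2)) * norm (fourier_kernel \<zeta> y)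
    \<le> exp (2 * pi\<^sup>2 / e * (norm (Im_vec \<zeta>))\<^sup>2) * exp (- (e / 2 * (norm y)\<^sup>2))"
proof -
  let ?b = "Im_vec \<zeta>"
  have "2 * pi * (y \<bullet> ?b) \<le> 2 * pi * (norm y * norm ?b)"
    by (intro mult_left_mono) (auto simp: norm_cauchy_schwarz)
  also have "\<dots> \<le> e / 2 * (norm y)\<^sup>2 + 2 * pi\<^sup>2 / e * (norm ?b)\<^sup>2"
  proof -
    have "0 \<le> (e * norm y - 2 * pi * norm ?b)\<^sup>2 / (2 * e)"
      using assms by simp
    also have "\<dots> = e / 2 * (norm y)\<^sup>2 + 2 * pi\<^sup>2 / e * (norm ?b)\<^sup>2 - 2 * pi * (norm y * norm ?b)"
      using assms by (simp add: power2_eq_square field_simps)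
    finally show ?thesis by simp
  qed
  finally show ?thesis
    unfolding norm_fourier_kernel exp_add[symmetric] by simp
qed

lemma norm_mult_fourier_kernel_le:
  assumes "e > 0" "C \<ge> 0" "norm (f y) \<le> C * exp (- (e * (norm y)\<^sup>2))"
  shows "norm (f y * fourier_kernel \<zeta> y)
    \<le> C * exp (2 * pi\<^sup>2 / e * (norm (Im_vec \<zeta>))\<^sup>2) * exp (- (e / 2 * (norm y)\<^sup>2))"
proof -
  have "norm (f y * fourier_kernel \<zeta> y) \<le> C * (exp (- (e * (norm y)\<^sup>2)) * norm (fourier_kernel \<zeta> y))"
    using mult_right_mono[OF assms(3), of "norm (fourier_kernel \<zeta> y)"] by (simp add: norm_mult mult.assoc)
  also have "\<dots> \<le> C * (exp (2 * pi\<^sup>2 / e * (norm (Im_vec \<zeta>))\<^sup>2) * exp (- (e / 2 * (norm y)\<^sup>2)))"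
    using assms by (intro mult_left_mono norm_fourier_kernel_gaussian)
  finally show ?thesis by (simp add: mult.assoc)
qed

section \<open>Transforms of functions with Gaussian decay\<close>

context
  fixes f :: "real ^ 'd::finite \<Rightarrow> complex" and C e :: real
  assumes f_meas [measurable]: "f \<in> borel_measurable borel"
    and e: "e > 0" and decay: "\<And>y. norm (f y) \<le> C * exp (- (e * (norm y)\<^sup>2))"
begin

private lemma C_nonneg: "C \<ge> 0"
  using decay[of 0] by (smt (verit) exp_gt_zero mult_neg_pos norm_ge_zero)

private lemmas integrand_le = norm_mult_fourier_kernel_le[OF e C_nonneg decay]

private lemma integrable_gaussian_half:
  "integrable lborel (\<lambda>y::real ^ 'd. K * exp (- (e / 2 * (norm y)\<^sup>2)))"
  using integrable_gaussian[of "e / 2", where 'a = "real ^ 'd"] e by (intro integrable_mult_right) auto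

lemma integrable_fourier_laplace: "integrable lborel (\<lambda>y. f y * fourier_kernel \<zeta> y)"
  by (rule Bochner_Integration.integrable_bound[OF integrable_gaussian_half[of "C * exp (2 * pi\<^sup>2 / e * (norm (Im_vec \<zeta>))\<^sup>2)"]])
     (measurable, use integrand_le C_nonneg in \<open>simp add: norm_mult\<close>)

text \<open>The bound is kept linear in \<open>C\<close>, because in the application to derivatives
  of the window \<open>C\<close> carries the dependence on their order.\<close>

lemma norm_fourier_laplace_le:
  "norm (fourier_laplace f \<zeta>) \<le>
     C * (LINT y|lborel. exp (- (e / 2 * (norm (y::real ^ 'd))\<^sup>2))) * exp (2 * pi\<^sup>2 / e * (norm (Im_vec \<zeta>))\<^sup>2)"
proof -
  have "norm (fourier_laplace f \<zeta>) \<le> (LINT y|lborel. C * exp (2 * pi\<^sup>2 / e * (norm (Im_vec \<zeta>))\<^sup>2) * exp (- (e / 2 * (norm (y::real ^ 'd))\<^sup>2)))"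
    unfolding fourier_laplace_def
    by (rule order.trans[OF integral_norm_bound integral_mono])
       (intro integrable_norm integrable_fourier_laplace integrable_gaussian_half integrand_le)+
  then show ?thesis by (simp add: mult_ac)
qed

lemma fourier_laplace_holomorphic_on:
  "(\<lambda>w. fourier_laplace f (complex_line \<omega> \<theta> w)) holomorphic_on ball 0 R"
  unfolding fourier_laplace_def
proof (rule holomorphic_on_lebesgue_integral)
  let ?K = "C * exp (2 * pi\<^sup>2 / e * (R * norm \<theta>)\<^sup>2)"
  show "(\<lambda>w. f y * fourier_kernel (complex_line \<omega> \<theta> w) y) holomorphic_on ball 0 R" for y
    unfolding fourier_kernel_complex_line by (intro holomorphic_intros)
  show "(\<lambda>y. f y * fourier_kernel (complex_line \<omega> \<theta> w) y) \<in> borel_measurable lborel" for w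
    by measurable
  show "integrable lborel (\<lambda>y::real ^ 'd. ?K * exp (- (e / 2 * (norm y)\<^sup>2)))"
    by (rule integrable_gaussian_half)
  fix w and y :: "real ^ 'd" assume w: "w \<in> ball (0::complex) R"
  have "\<bar>Im w\<bar> \<le> R" using w abs_Im_le_cmod[of w] by simp
  then have "norm (Im_vec (complex_line \<omega> \<theta> w)) \<le> R * norm \<theta>"
    by (simp add: Im_vec_complex_line mult_right_mono)
  then have "C * exp (2 * pi\<^sup>2 / e * (norm (Im_vec (complex_line \<omega> \<theta> w)))\<^sup>2) \<le> ?K"
    using C_nonneg e by (intro mult_left_mono iffD2[OF exp_le_cancel_iff] power_mono) auto
  with integrand_le[of y "complex_line \<omega> \<theta> w"]
  show "norm (f y * fourier_kernel (complex_line \<omega> \<theta> w) y) \<le> ?K * exp (- (e / 2 * (norm y)\<^sup>2))"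
    by (meson exp_ge_zero mult_right_mono order.trans)
qed auto

end

lemma fourier_laplace_measurable [measurable]:
  fixes f :: "real ^ 'd::finite \<Rightarrow> complex" and Z :: "real ^ 'd \<Rightarrow> complex ^ 'd"
  assumes [measurable]: "f \<in> borel_measurable borel"
    and Z: "\<And>j. (\<lambda>x. Z x $ j) \<in> borel_measurable borel"
  shows "(\<lambda>x. fourier_laplace f (Z x)) \<in> borel_measurable borel"
proof -
  have [measurable]: "(\<lambda>x. Z x $ j) \<in> borel_measurable borel" for j by (rule Z)
  show ?thesis
    unfolding fourier_laplace_def fourier_kernel_def
    by (rule lborel.borel_measurable_lebesgue_integral) measurable
qed

text \<open>The difference quotients of \<open>f\<close> in direction \<open>j\<close> are moved to the exponential by a
  translation of the integration variable.\<close>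

lemma fourier_laplace_partial:
  fixes f f' :: "real ^ 'd::finite \<Rightarrow> complex"
  assumes meas: "f \<in> borel_measurable borel" "f' \<in> borel_measurable borel"
    and e: "e > 0"
    and f: "\<And>y. norm (f y) \<le> C * exp (- (e * (norm y)\<^sup>2))"
    and f': "\<And>y. norm (f' y) \<le> C' * exp (- (e * (norm y)\<^sup>2))"
    and deriv: "\<And>y. ((\<lambda>s. f (y + s *\<^sub>R axis j 1)) has_vector_derivative f' y) (at 0)"
  shows "fourier_laplace f' \<zeta> = 2 * of_real pi * \<i> * \<zeta> $ j * fourier_laplace f \<zeta>"
proof -
  note [measurable] = meas
  let ?k = "fourier_kernel \<zeta>" and ?v = "axis j 1 :: real ^ 'd"
  define X where "X n = 1 / real (Suc n)" for n
  have X: "0 < X n" "X n \<le> 1" for n by (auto simp: X_def)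
  then have X0: "X n \<noteq> 0" for n by (metis less_irrefl)
  have X_lim: "X \<longlonglongrightarrow> 0" unfolding X_def by (rule LIMSEQ_Suc[OF lim_1_over_n])
  have C': "C' \<ge> 0"
    using f'[of 0] by (smt (verit) exp_gt_zero mult_neg_pos norm_ge_zero)
  define q where "q n y = (f (y + X n *\<^sub>R ?v) - f y) /\<^sub>R X n" for n y
  have deriv_s: "((\<lambda>s. f (y + s *\<^sub>R ?v)) has_vector_derivative f' (y + r *\<^sub>R ?v)) (at r)" for y r
  proof -
    have "((\<lambda>s. f ((y + r *\<^sub>R ?v) + s *\<^sub>R ?v)) \<circ> (\<lambda>s. s - r) has_vector_derivative 1 *\<^sub>R f' (y + r *\<^sub>R ?v)) (at r)"
      using deriv[of "y + r *\<^sub>R ?v"]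
      by (intro vector_diff_chain_at) (auto intro!: derivative_eq_intros)
    then show ?thesis by (simp add: comp_def algebra_simps)
  qed
  \<comment> \<open>The mean value inequality bounds the quotient by \<open>f'\<close> at a point at
    distance less than 1 from \<open>y\<close>. The shift costs the factor \<open>exp e\<close> and
    half of the Gaussian rate, so the majorant does not depend on \<open>n\<close>.\<close>
  have q_le: "norm (q n y) \<le> (C' * exp e) * exp (- (e / 2 * (norm y)\<^sup>2))" for n y
  proof -
    have "\<exists>r\<in>{0<..<X n}. norm (f (y + X n *\<^sub>R ?v) - f (y + 0 *\<^sub>R ?v))
        \<le> norm ((X n - 0) *\<^sub>R f' (y + r *\<^sub>R ?v))"
      using deriv_s[unfolded has_vector_derivative_def] X(1)
      by (intro mvt_general continuous_at_imp_continuous_on)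
         (auto intro: has_derivative_continuous)
    then obtain r where r: "0 < r" "r < X n" "norm (f (y + X n *\<^sub>R ?v) - f y) \<le> X n * norm (f' (y + r *\<^sub>R ?v))"
      using X(1)[of n] by auto
    have "norm (q n y) \<le> norm (f' (y + r *\<^sub>R ?v))"
      using r(3) X(1)[of n] by (simp add: q_def divide_simps mult.commute)
    also have "\<dots> \<le> C' * exp (- (e * (norm (y + r *\<^sub>R ?v))\<^sup>2))" by (rule f')
    also have "\<dots> \<le> C' * exp (e + - (e / 2 * (norm y)\<^sup>2))"
    proof (intro mult_left_mono iffD2[OF exp_le_cancel_iff] C')
      have "norm y \<le> norm (y + r *\<^sub>R ?v) + norm (r *\<^sub>R ?v)"
        by (metis add_diff_cancel_right' norm_triangle_ineq4)
      also have "norm (r *\<^sub>R ?v) \<le> 1" using r X(2)[of n] by (simp add: norm_axis_1)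
      finally have "(norm y)\<^sup>2 \<le> (norm (y + r *\<^sub>R ?v) + 1)\<^sup>2"
        by (intro power_mono) auto
      also have "\<dots> \<le> 2 * (norm (y + r *\<^sub>R ?v))\<^sup>2 + 2"
        using zero_le_power2[of "norm (y + r *\<^sub>R ?v) - 1"] by (simp add: power2_eq_square algebra_simps)
      finally show "- (e * (norm (y + r *\<^sub>R ?v))\<^sup>2) \<le> e + - (e / 2 * (norm y)\<^sup>2)"
        using e by (simp add: field_simps) (metis mult_le_cancel_left_pos distrib_left mult.commute mult_2)
    qed
    finally show ?thesis by (simp only: exp_add mult.assoc)
  qed
  have "(\<lambda>n. LINT y|lborel. q n y * ?k y) \<longlonglongrightarrow> fourier_laplace f' \<zeta>"
    unfolding fourier_laplace_def
  proof (rule integral_dominated_convergence)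
    let ?K = "C' * exp e * exp (2 * pi\<^sup>2 / (e / 2) * (norm (Im_vec \<zeta>))\<^sup>2)"
    show "integrable lborel (\<lambda>y::real ^ 'd. ?K * exp (- (e / 2 / 2 * (norm y)\<^sup>2)))"
      using e by (intro integrable_mult_right integrable_gaussian) auto
    show "AE y in lborel. norm (q n y * ?k y) \<le> ?K * exp (- (e / 2 / 2 * (norm y)\<^sup>2))" for n
      using e C' by (intro AE_I2 norm_mult_fourier_kernel_le q_le) auto
    show "AE y in lborel. (\<lambda>n. q n y * ?k y) \<longlonglongrightarrow> f' y * ?k y"
    proof (intro AE_I2 tendsto_mult tendsto_const)
      fix y
      have "((\<lambda>s. norm (f (y + s *\<^sub>R ?v) - f y - s *\<^sub>R f' y) / norm s) \<longlongrightarrow> 0) (at 0)"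
        using deriv[of y] by (simp add: has_vector_derivative_def has_derivative_at)
      then have "(\<lambda>n. norm (f (y + X n *\<^sub>R ?v) - f y - X n *\<^sub>R f' y) / norm (X n)) \<longlonglongrightarrow> 0"
        unfolding tendsto_at_iff_sequentially comp_def using X0 X_lim by auto
      moreover have "norm (f (y + X n *\<^sub>R ?v) - f y - X n *\<^sub>R f' y) / norm (X n) = norm (q n y - f' y)" for n
      proof -
        have "q n y - f' y = (f (y + X n *\<^sub>R ?v) - f y - X n *\<^sub>R f' y) /\<^sub>R X n"
          using X(1)[of n] by (simp add: q_def scaleR_diff_right)
        then show ?thesis by (simp add: divide_inverse mult.commute)
      qed
      ultimately have "(\<lambda>n. norm (q n y - f' y)) \<longlonglongrightarrow> 0" by simp
      then show "(\<lambda>n. q n y) \<longlonglongrightarrow> f' y"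
        by (rule LIM_zero_cancel[OF tendsto_norm_zero_cancel])
    qed
    show "(\<lambda>y. q n y * ?k y) \<in> borel_measurable lborel" for n
      unfolding q_def by measurable
  qed measurable
  moreover have "(LINT y|lborel. q n y * ?k y) =
      (exp (2 * of_real pi * \<i> * \<zeta> $ j * of_real (X n)) - 1) / of_real (X n) * fourier_laplace f \<zeta>" for n
  proof -
    define c where "c = exp (2 * of_real pi * \<i> * \<zeta> $ j * of_real (X n))"
    have c: "c * ?k (X n *\<^sub>R ?v) = 1"
      by (simp add: c_def fourier_kernel_scaleR_axis exp_add[symmetric])
    have int: "integrable lborel (\<lambda>y. f y * ?k y)"
      by (rule integrable_fourier_laplace[OF meas(1) e f])
    have eq: "f (y + X n *\<^sub>R ?v) * ?k y = c * (f (y + X n *\<^sub>R ?v) * ?k (y + X n *\<^sub>R ?v))" for y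
      using c by (simp add: fourier_kernel_add algebra_simps)
    have int': "integrable lborel (\<lambda>y. f (y + X n *\<^sub>R ?v) * ?k y)"
      unfolding eq using integrable_lborel_translation[OF int, of "X n *\<^sub>R ?v"]
      by (intro integrable_mult_right) (simp add: add.commute)
    have "(LINT y|lborel. f (y + X n *\<^sub>R ?v) * ?k y) = c * fourier_laplace f \<zeta>"
      unfolding eq using integral_lborel_translation[of "\<lambda>y. f y * ?k y" "X n *\<^sub>R ?v"]
      by (simp add: add.commute fourier_laplace_def)
    then have "(LINT y|lborel. (f (y + X n *\<^sub>R ?v) * ?k y - f y * ?k y) / of_real (X n))
        = (c * fourier_laplace f \<zeta> - fourier_laplace f \<zeta>) / of_real (X n)"
      using int int' by (simp add: fourier_laplace_def)
    moreover have "q n y * ?k y = (f (y + X n *\<^sub>R ?v) * ?k y - f y * ?k y) / of_real (X n)" for y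
      by (simp add: q_def scaleR_conv_of_real field_simps)
    ultimately show ?thesis
      by (simp add: c_def left_diff_distrib)
  qed
  moreover have "(\<lambda>n. (exp (2 * of_real pi * \<i> * \<zeta> $ j * of_real (X n)) - 1) / of_real (X n) * fourier_laplace f \<zeta>)
      \<longlonglongrightarrow> 2 * of_real pi * \<i> * \<zeta> $ j * fourier_laplace f \<zeta>"
  proof (intro tendsto_mult tendsto_const)
    let ?a = "2 * of_real pi * \<i> * \<zeta> $ j"
    have "((\<lambda>s. exp (?a * s)) has_field_derivative ?a) (at 0)"
      by (auto intro!: derivative_eq_intros)
    then have "((\<lambda>s. (exp (?a * s) - 1) / s) \<longlongrightarrow> ?a) (at 0)"
      by (simp add: has_field_derivative_iff)
    moreover have "(\<lambda>n. complex_of_real (X n)) \<longlonglongrightarrow> 0"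
      using tendsto_of_real[OF X_lim, where ?'a = complex] by simp
    ultimately show "(\<lambda>n. (exp (?a * of_real (X n)) - 1) / of_real (X n)) \<longlonglongrightarrow> ?a"
      unfolding tendsto_at_iff_sequentially comp_def using X0 by auto
  qed
  ultimately show ?thesis
    by (simp add: LIMSEQ_unique)
qed


section \<open>Windows of Gelfand--Shilov class\<close>

text \<open>Reduces Gaussian decay in the full norm to decay in the largest coordinate, at the price
  of the factor \<open>CARD('d)\<close> in the rate.\<close>

lemma ex_norm_le_card_component:
  fixes x :: "'a::real_normed_vector ^ 'd::finite"
  shows "\<exists>i. (norm x)\<^sup>2 \<le> real CARD('d) * (norm (x $ i))\<^sup>2"
proof -
  have "Max (range (\<lambda>j. norm (x $ j))) \<in> range (\<lambda>j. norm (x $ j))"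
    by (intro Max_in) auto
  then obtain i where i: "Max (range (\<lambda>j. norm (x $ j))) = norm (x $ i)" by (rule rangeE)
  have max: "norm (x $ j) \<le> norm (x $ i)" for j
    unfolding i[symmetric] by (intro Max_ge) auto
  have "(norm x)\<^sup>2 = (\<Sum>j\<in>UNIV. (norm (x $ j))\<^sup>2)"
    by (simp add: norm_vec_def L2_set_def sum_nonneg)
  also have "\<dots> \<le> (\<Sum>j\<in>(UNIV::'d set). (norm (x $ i))\<^sup>2)"
    by (intro sum_mono power_mono max) auto
  finally show ?thesis by (intro exI[of _ i]) simp
qed

text \<open>The list chosen by \<open>SOME\<close> is forced here: all its entries equal
  \<open>j\<close> and its length is \<open>n\<close>.\<close>

lemma multi_partial_single: "multi_partial (\<lambda>i. if i = j then n else 0) = iter_partial (replicate n j)"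
proof -
  define js where "js = (SOME js. \<forall>i. count_list js i = (if i = j then n else 0))"
  have js: "count_list js i = (if i = j then n else 0)" for i
    using someI_ex[OF ex_list_count[of "\<lambda>i. if i = j then n else 0"]] unfolding js_def by blast
  have "i = j" if "i \<in> set js" for i
    using js[of i] that by (auto simp: count_list_0_iff split: if_splits)
  then have rep: "js = replicate (length js) j"
    by (intro replicate_eqI) auto
  have "count_list (replicate k j) j = k" for k
    by (induction k) auto
  with js[of j] rep have "length js = n" by metis
  with rep show ?thesis by (simp add: multi_partial_def js_def)
qed

text \<open>The exponent 1/2 on \<open>multi_fact \<alpha>\<close> supplies exactly the
  \<open>sqrt (fact k)\<close> of the moment criterion, applied to powers of the largest coordinate.
  The factor in the derivative order is carried along as a constant.\<close>

lemma gelfand_shilov_half_iter_partial_bound: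
  fixes g :: "real ^ 'd::finite \<Rightarrow> complex"
  assumes "g \<in> gelfand_shilov (1 / 2) (1 / 2)"
  obtains C B e :: real where "C > 0" "B > 0" "e > 0"
    "\<And>j n x. norm (iter_partial (replicate n j) g x) \<le> C * B ^ n * sqrt (fact n) * exp (- (e * (norm x)\<^sup>2))"
proof -
  obtain A B c :: real where ABc: "A > 0" "B > 0" "c > 0"
    and bound: "\<And>x \<alpha> \<beta>. norm (multi_power x \<alpha> *\<^sub>R multi_partial \<beta> g x)
       \<le> c * A ^ multi_deg \<alpha> * B ^ multi_deg \<beta> * multi_fact \<alpha> powr (1 / 2) * multi_fact \<beta> powr (1 / 2)"
    using assms unfolding gelfand_shilov_def by blast
  have deg: "multi_deg (\<lambda>i. if i = j then n else 0) = n" for j :: 'd and n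
    by (simp add: multi_deg_def)
  have fact: "multi_fact (\<lambda>i. if i = j then n else 0) = fact n" for j :: 'd and n
    by (simp add: multi_fact_def if_distrib[of "\<lambda>k. fact k :: real"] cong: if_cong)
  have power: "multi_power x (\<lambda>i. if i = j then n else 0) = (x $ j) ^ n" for x :: "real ^ 'd" and j n
    by (simp add: multi_power_def if_distrib[of "\<lambda>k. _ ^ k"] cong: if_cong)
  have "norm (iter_partial (replicate n j) g x)
      \<le> (sqrt 2 * c) * B ^ n * sqrt (fact n) * exp (- (1 / (4 * CARD('d) * A\<^sup>2) * (norm x)\<^sup>2))" for j n x
  proof -
    obtain i where i: "(norm x)\<^sup>2 \<le> real CARD('d) * (norm (x $ i))\<^sup>2"
      using ex_norm_le_card_component by blast
    have "norm (iter_partial (replicate n j) g x)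
        \<le> sqrt 2 * (c * B ^ n * sqrt (fact n)) * exp (- (\<bar>x $ i\<bar>\<^sup>2 / (4 * A\<^sup>2)))"
    proof (rule gaussian_bound_of_moments)
      fix k
      show "\<bar>x $ i\<bar> ^ k * norm (iter_partial (replicate n j) g x) \<le> c * B ^ n * sqrt (fact n) * A ^ k * sqrt (fact k)"
        using bound[of x "\<lambda>i'. if i' = i then k else 0" "\<lambda>i. if i = j then n else 0"]
        unfolding deg fact power multi_partial_single
        by (simp add: powr_half_sqrt power_abs mult_ac)
    qed (use ABc in auto)
    also have "\<dots> \<le> sqrt 2 * (c * B ^ n * sqrt (fact n)) * exp (- (1 / (4 * CARD('d) * A\<^sup>2) * (norm x)\<^sup>2))"
    proof (intro mult_left_mono iffD2[OF exp_le_cancel_iff])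
      have "(norm x)\<^sup>2 / (4 * CARD('d) * A\<^sup>2) \<le> CARD('d) * (norm (x $ i))\<^sup>2 / (4 * CARD('d) * A\<^sup>2)"
        by (intro divide_right_mono i) auto
      also have "\<dots> = \<bar>x $ i\<bar>\<^sup>2 / (4 * A\<^sup>2)" by simp
      finally show "- (\<bar>x $ i\<bar>\<^sup>2 / (4 * A\<^sup>2)) \<le> - (1 / (4 * CARD('d) * A\<^sup>2) * (norm x)\<^sup>2)" by simp
    qed (use ABc in auto)
    finally show ?thesis by (simp add: mult.assoc)
  qed
  moreover have "sqrt 2 * c > 0" "1 / (4 * CARD('d) * A\<^sup>2) > 0" using ABc by auto
  ultimately show thesis using ABc(2) that by blast
qed

lemma gelfand_shilov_iter_partial_differentiable:
  "g \<in> gelfand_shilov r s \<Longrightarrow> iter_partial js g differentiable (at x)"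
  by (simp add: gelfand_shilov_def schwartz_def smooth_fun_def)

lemma gelfand_shilov_iter_partial_measurable:
  fixes g :: "real ^ 'd::finite \<Rightarrow> complex"
  assumes "g \<in> gelfand_shilov r s"
  shows "iter_partial js g \<in> borel_measurable borel"
  using gelfand_shilov_iter_partial_differentiable[OF assms]
  by (intro borel_measurable_continuous_onI continuous_at_imp_continuous_on ballI differentiable_imp_continuous_within)

lemma has_vector_derivative_partial_deriv:
  assumes "f differentiable (at y)"
  shows "((\<lambda>s. f (y + s *\<^sub>R axis j 1)) has_vector_derivative partial_deriv j f y) (at 0)"
proof -
  have "((\<lambda>s::real. y + s *\<^sub>R axis j 1) has_derivative (\<lambda>s. s *\<^sub>R axis j 1)) (at 0)"
    by (auto intro!: derivative_eq_intros)
  moreover have "f differentiable (at (y + 0 *\<^sub>R axis j 1))" using assms by simp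
  ultimately have "(f \<circ> (\<lambda>s::real. y + s *\<^sub>R axis j 1)) differentiable (at 0)"
    by (intro differentiable_chain_at) (auto simp: differentiable_def)
  then show ?thesis
    unfolding partial_deriv_def by (simp add: vector_derivative_works comp_def)
qed

text \<open>Each derivative multiplies the transform by \<open>2 * pi * \<i> * \<zeta> $ j\<close>,
  so derivative bounds of the window become moment bounds of its transform. The moment criterion
  turns these into Gaussian decay in \<zeta>, with the growth in \<open>Im_vec \<zeta>\<close> as a
  constant.\<close>

lemma fourier_laplace_gelfand_shilov_half_bound:
  fixes g :: "real ^ 'd::finite \<Rightarrow> complex"
  assumes g: "g \<in> gelfand_shilov (1 / 2) (1 / 2)"
  obtains C K e :: real where "C > 0" "K > 0" "e > 0"
    "\<And>\<zeta>. norm (fourier_laplace g \<zeta>) \<le> C * exp (K * (norm (Im_vec \<zeta>))\<^sup>2 - e * (norm \<zeta>)\<^sup>2)"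
proof -
  obtain C B e where CBe: "C > 0" "B > 0" "e > 0"
    and bound: "\<And>j n x. norm (iter_partial (replicate n j) g x) \<le> C * B ^ n * sqrt (fact n) * exp (- (e * (norm x)\<^sup>2))"
    using gelfand_shilov_half_iter_partial_bound[OF g] by blast
  note meas = gelfand_shilov_iter_partial_measurable[OF g]
  have power: "fourier_laplace (iter_partial (replicate n j) g) \<zeta> = (2 * of_real pi * \<i> * \<zeta> $ j) ^ n * fourier_laplace g \<zeta>"
    for j n \<zeta>
  proof (induction n)
    case (Suc n)
    have "fourier_laplace (iter_partial (replicate (Suc n) j) g) \<zeta>
        = 2 * of_real pi * \<i> * \<zeta> $ j * fourier_laplace (iter_partial (replicate n j) g) \<zeta>"
      by (rule fourier_laplace_partial[OF meas meas CBe(3) bound bound])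
         (simp add: has_vector_derivative_partial_deriv gelfand_shilov_iter_partial_differentiable[OF g])
    with Suc show ?case by simp
  qed simp
  define I where "I = (LINT y|lborel. exp (- (e / 2 * (norm (y::real ^ 'd))\<^sup>2)))"
  have I: "I \<ge> 0" by (simp add: I_def)
  define K where "K = 2 * pi\<^sup>2 / e"
  have "norm (fourier_laplace g \<zeta>)
      \<le> (sqrt 2 * (C * (I + 1))) * exp (K * (norm (Im_vec \<zeta>))\<^sup>2 - pi\<^sup>2 / (CARD('d) * B\<^sup>2) * (norm \<zeta>)\<^sup>2)" for \<zeta>
  proof -
    obtain j where j: "(norm \<zeta>)\<^sup>2 \<le> real CARD('d) * (norm (\<zeta> $ j))\<^sup>2"
      using ex_norm_le_card_component by blast
    have "norm (fourier_laplace g \<zeta>)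
        \<le> sqrt 2 * (C * I * exp (K * (norm (Im_vec \<zeta>))\<^sup>2)) * exp (- ((2 * pi * norm (\<zeta> $ j))\<^sup>2 / (4 * B\<^sup>2)))"
    proof (rule gaussian_bound_of_moments)
      fix n
      have "(2 * pi * norm (\<zeta> $ j)) ^ n * norm (fourier_laplace g \<zeta>) = norm (fourier_laplace (iter_partial (replicate n j) g) \<zeta>)"
        unfolding power by (simp add: norm_mult norm_power)
      also have "\<dots> \<le> C * B ^ n * sqrt (fact n) * I * exp (K * (norm (Im_vec \<zeta>))\<^sup>2)"
        unfolding I_def K_def by (rule norm_fourier_laplace_le[OF meas CBe(3) bound])
      finally show "(2 * pi * norm (\<zeta> $ j)) ^ n * norm (fourier_laplace g \<zeta>)
          \<le> C * I * exp (K * (norm (Im_vec \<zeta>))\<^sup>2) * B ^ n * sqrt (fact n)"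
        by (simp add: mult_ac)
    qed (use CBe in auto)
    \<comment> \<open>\<open>I + 1\<close> in place of \<open>I\<close> makes the constant positive
      at sight.\<close>
    also have "\<dots> \<le> sqrt 2 * (C * (I + 1) * exp (K * (norm (Im_vec \<zeta>))\<^sup>2)) * exp (- (pi\<^sup>2 / (CARD('d) * B\<^sup>2) * (norm \<zeta>)\<^sup>2))"
    proof (intro mult_mono mult_left_mono mult_right_mono iffD2[OF exp_le_cancel_iff])
      have "pi\<^sup>2 / (CARD('d) * B\<^sup>2) * (norm \<zeta>)\<^sup>2 \<le> pi\<^sup>2 / (CARD('d) * B\<^sup>2) * (CARD('d) * (norm (\<zeta> $ j))\<^sup>2)"
        by (intro mult_left_mono j) auto
      also have "\<dots> = (2 * pi * norm (\<zeta> $ j))\<^sup>2 / (4 * B\<^sup>2)"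
        by (simp add: power_mult_distrib)
      finally show "- ((2 * pi * norm (\<zeta> $ j))\<^sup>2 / (4 * B\<^sup>2)) \<le> - (pi\<^sup>2 / (CARD('d) * B\<^sup>2) * (norm \<zeta>)\<^sup>2)" by simp
    qed (use CBe I in \<open>auto simp: K_def\<close>)
    finally show ?thesis by (simp add: exp_diff exp_minus divide_inverse mult_ac)
  qed
  moreover have "sqrt 2 * (C * (I + 1)) > 0" "K > 0" "pi\<^sup>2 / (CARD('d) * B\<^sup>2) > 0"
    using CBe I by (auto simp: K_def add_nonneg_pos)
  ultimately show thesis using that by blast
qed

text \<open>The integral is holomorphic in \<open>w\<close> and, by translation invariance, constant
  for real \<open>w\<close>; the identity theorem carries this over to \<open>w = \<i>\<close>. The
  radius 2 leaves room for \<i>.\<close>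

lemma integral_complex_shift:
  fixes H :: "complex ^ 'd::finite \<Rightarrow> complex"
  assumes holo: "\<And>\<omega>. (\<lambda>w. H (complex_line \<omega> \<theta> w)) holomorphic_on ball 0 2"
    and meas: "\<And>w. (\<lambda>\<omega>. H (complex_line \<omega> \<theta> w)) \<in> borel_measurable borel"
    and B: "integrable lborel B" "\<And>w \<omega>. norm w < 2 \<Longrightarrow> norm (H (complex_line \<omega> \<theta> w)) \<le> B \<omega>"
  shows "(LINT \<omega>|lborel. H (complex_line \<omega> \<theta> \<i>)) = (LINT \<omega>|lborel. H (complex_vec \<omega>))"
proof -
  define I where "I w = (LINT \<omega>|lborel. H (complex_line \<omega> \<theta> w))" for w
  have holo_I: "I holomorphic_on ball 0 2"
    unfolding I_def by (rule holomorphic_on_lebesgue_integral[OF _ holo _ B(1)]) (use meas B(2) in auto)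
  have I_real: "I (of_real r) = I 0" for r
  proof -
    have vec: "complex_line \<omega> \<theta> (of_real r) = complex_line (r *\<^sub>R \<theta> + \<omega>) \<theta> 0" for \<omega>
      by (simp add: complex_line_def vec_eq_iff)
    show ?thesis
      unfolding I_def vec by (rule integral_lborel_translation) (rule meas)
  qed
  let ?U = "of_real ` {-1<..<1} :: complex set"
  have "I \<i> - I 0 = 0"
  proof (rule analytic_continuation[of "\<lambda>w. I w - I 0" "ball 0 2" ?U 0])
    show "(\<lambda>w. I w - I 0) holomorphic_on ball 0 2" by (intro holomorphic_intros holo_I)
    show "?U \<subseteq> ball 0 2" by auto
    show "0 islimpt ?U"
      unfolding islimpt_approachable
    proof (intro allI impI)
      fix e :: real assume "e > 0"
      then show "\<exists>x'\<in>?U. x' \<noteq> 0 \<and> dist x' 0 < e"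
        by (intro bexI[of _ "of_real (min (e / 2) (1 / 2))"]) auto
    qed
  qed (auto simp: I_real)
  moreover have "complex_line \<omega> \<theta> 0 = complex_vec \<omega>" for \<omega>
    by (simp add: complex_line_def complex_vec_def)
  ultimately show ?thesis by (simp add: I_def)
qed

text \<open>Parseval's formula from Fubini's theorem: the kernel has modulus 1, so integrability of
  \<open>h\<close> and \<open>f\<close> gives that of the double integrand.\<close>

lemma L2_pairing_inverse_fourier:
  fixes h f :: "real ^ 'd::finite \<Rightarrow> complex"
  assumes h: "integrable lborel h" and f: "integrable lborel f"
  shows "L2_pairing (inverse_fourier h) f = (LINT \<omega>|lborel. h \<omega> * cnj (fourier f \<omega>))"
proof -
  have [measurable]: "h \<in> borel_measurable borel" "f \<in> borel_measurable borel"
    using h f by auto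
  have [measurable]: "cnj \<in> borel_measurable borel"
    by (intro borel_measurable_continuous_onI continuous_intros)
  let ?k = "\<lambda>\<omega> y::real ^ 'd. exp (2 * of_real pi * \<i> * of_real (y \<bullet> \<omega>)) :: complex"
  have norm_k: "norm (?k \<omega> y) = 1" for \<omega> y by (simp add: norm_exp_eq_Re)
  have "integrable (lborel \<Otimes>\<^sub>M lborel) (\<lambda>(\<omega>, y). h \<omega> * (?k \<omega> y * cnj (f y)))"
  proof (rule lborel_pair.Fubini_integrable)
    show "(\<lambda>(\<omega>, y). h \<omega> * (?k \<omega> y * cnj (f y))) \<in> borel_measurable (lborel \<Otimes>\<^sub>M lborel)"
      by measurable
    show "integrable lborel (\<lambda>\<omega>. LINT y|lborel. norm (case (\<omega>, y) of (\<omega>, y) \<Rightarrow> h \<omega> * (?k \<omega> y * cnj (f y))))"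
      using h f by (simp add: norm_mult norm_k)
    have "integrable lborel (\<lambda>y. h \<omega> * (?k \<omega> y * cnj (f y)))" for \<omega>
      by (rule Bochner_Integration.integrable_bound[of _ "\<lambda>y. norm (h \<omega>) * norm (f y)"])
         (use f in \<open>auto simp: norm_mult norm_k\<close>)
    then show "AE \<omega> in lborel. integrable lborel (\<lambda>y. case (\<omega>, y) of (\<omega>, y) \<Rightarrow> h \<omega> * (?k \<omega> y * cnj (f y)))"
      by simp
  qed
  from lborel_pair.Fubini_integral[OF this]
  have swap: "(LINT y|lborel. LINT \<omega>|lborel. h \<omega> * (?k \<omega> y * cnj (f y))) =
      (LINT \<omega>|lborel. LINT y|lborel. h \<omega> * (?k \<omega> y * cnj (f y)))" .
  have pairing: "L2_pairing (inverse_fourier h) f = (LINT y|lborel. LINT \<omega>|lborel. h \<omega> * (?k \<omega> y * cnj (f y)))"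
    unfolding L2_pairing_def inverse_fourier_def by (simp add: mult.assoc flip: integral_mult_left_zero)
  have inner: "(LINT y|lborel. h \<omega> * (?k \<omega> y * cnj (f y))) = h \<omega> * cnj (fourier f \<omega>)" for \<omega>
  proof -
    have "cnj (fourier f \<omega>) = (LINT y|lborel. cnj (f y * exp (- 2 * of_real pi * \<i> * of_real (y \<bullet> \<omega>))))"
      unfolding fourier_def by (rule Bochner_Integration.integral_cnj[symmetric])
    also have "\<dots> = (LINT y|lborel. ?k \<omega> y * cnj (f y))"
      by (simp add: exp_cnj mult.commute)
    finally show ?thesis by simp
  qed
  show ?thesis unfolding pairing swap inner ..
qed

lemma fourier_eq_fourier_laplace: "fourier f \<omega> = fourier_laplace f (complex_vec \<omega>)"
  by (simp add: fourier_def fourier_laplace_def fourier_kernel_def complex_vec_def inner_vec_def)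

lemma fourier_tf_shift:
  fixes f :: "real ^ 'd::finite \<Rightarrow> complex"
  assumes [measurable]: "f \<in> borel_measurable borel"
  shows "fourier (tf_shift (x, \<xi>) f) \<omega> =
    exp (- 2 * of_real pi * \<i> * of_real (x \<bullet> (\<omega> - \<xi>))) * fourier f (\<omega> - \<xi>)"
proof -
  let ?F = "\<lambda>y. tf_shift (x, \<xi>) f y * exp (- 2 * of_real pi * \<i> * of_real (y \<bullet> \<omega>))"
  have "fourier (tf_shift (x, \<xi>) f) \<omega> = (LINT y|lborel. ?F (x + y))"
    unfolding fourier_def by (subst integral_lborel_translation) (auto simp: tf_shift_def)
  also have "(\<lambda>y. ?F (x + y)) = (\<lambda>y. exp (- 2 * of_real pi * \<i> * of_real (x \<bullet> (\<omega> - \<xi>))) *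
      (f y * exp (- 2 * of_real pi * \<i> * of_real (y \<bullet> (\<omega> - \<xi>)))))"
    by (simp add: fun_eq_iff tf_shift_def exp_add[symmetric] exp_diff[symmetric] algebra_simps inner_commute)
  finally show ?thesis by (simp add: fourier_def)
qed


section \<open>The matrix coefficients of the propagator\<close>

lemma power2_add_le: "(x + y)\<^sup>2 \<le> 2 * x\<^sup>2 + 2 * y\<^sup>2" for x y :: real
  using sum_squares_bound[of x y] by (simp add: power2_sum)

lemma complex_line_minus_complex_vec: "complex_line \<omega> \<theta> w - complex_vec \<xi> = complex_line (\<omega> - \<xi>) \<theta> w"
  by (simp add: complex_line_def complex_vec_def vec_eq_iff)

lemma complex_vec_minus_complex_line: "complex_vec \<xi> - complex_line \<omega> \<theta> w = complex_line (\<xi> - \<omega>) (- \<theta>) w"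
  by (simp add: complex_line_def complex_vec_def vec_eq_iff)

lemma complex_vec_diff: "complex_vec (x - y) = complex_vec x - complex_vec y"
  by (simp add: complex_vec_def vec_eq_iff)

lemma norm_Re_le_norm_complex_line: "norm (\<omega> + Re w *\<^sub>R \<theta>) \<le> norm (complex_line \<omega> \<theta> w)"
  unfolding norm_vec_def
proof (rule L2_set_mono)
  show "norm ((\<omega> + Re w *\<^sub>R \<theta>) $ j) \<le> norm (complex_line \<omega> \<theta> w $ j)" for j
    using abs_Re_le_cmod[of "complex_line \<omega> \<theta> w $ j"] by (simp add: complex_line_def)
qed auto

lemma cpoly_eval_complex_line_measurable [measurable]:
  "(\<lambda>\<omega>. cpoly_eval p (complex_line \<omega> \<theta> w)) \<in> borel_measurable borel"
  unfolding cpoly_eval_def multi_power_def complex_line_def by (simp, measurable)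

lemma fourier_laplace_complex_line_measurable [measurable]:
  assumes "f \<in> borel_measurable borel"
  shows "(\<lambda>\<omega>. fourier_laplace f (complex_line \<omega> \<theta> w - complex_vec \<xi>)) \<in> borel_measurable borel"
    and "(\<lambda>\<omega>. fourier_laplace f (complex_vec \<xi> - complex_line \<omega> \<theta> w)) \<in> borel_measurable borel"
  by (intro fourier_laplace_measurable assms; simp add: complex_line_def; measurable)+

text \<open>Serves to extend \<open>cnj (fourier g \<omega>)\<close> holomorphically: for real
  \<omega> it is the transform of the conjugate window at \<open>- \<omega>\<close>, an expression
  free of conjugation in the frequency.\<close>

lemma fourier_laplace_cnj:
  "fourier_laplace (\<lambda>y. cnj (f y)) \<zeta> = cnj (fourier_laplace f (\<chi> j. - cnj (\<zeta> $ j)))"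
  unfolding fourier_laplace_def Bochner_Integration.integral_cnj[symmetric]
  by (intro Bochner_Integration.integral_cong) (simp_all add: fourier_kernel_def exp_cnj sum_negf)

lemma norm_tf_shift: "norm (tf_shift (x, \<xi>) f y) = norm (f (y - x))"
  by (simp add: tf_shift_def norm_mult norm_exp_eq_Re)

lemma integrable_tf_shift:
  fixes f :: "real ^ 'd::finite \<Rightarrow> complex"
  assumes "integrable lborel f"
  shows "integrable lborel (tf_shift (x, \<xi>) f)"
proof (rule Bochner_Integration.integrable_bound)
  have [measurable]: "f \<in> borel_measurable borel" using assms by auto
  show "integrable lborel (\<lambda>y. f (- x + y))" by (rule integrable_lborel_translation[OF assms])
  show "tf_shift (x, \<xi>) f \<in> borel_measurable lborel"
    unfolding tf_shift_def by simp
  show "AE y in lborel. norm (tf_shift (x, \<xi>) f y) \<le> norm (f (- x + y))"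
    by (simp add: norm_tf_shift)
qed

lemma propagator_pairing_bound:
  fixes g :: "real ^ 'd::finite \<Rightarrow> complex"
  assumes m: "m \<ge> 1" and t: "t \<ge> 0" and C\<^sub>0: "C\<^sub>0 > 0"
    and roots: "\<And>s \<zeta>. op_symbol m a s \<zeta> = 0 \<Longrightarrow> Re s \<le> C\<^sub>0 * (1 + norm (Im_vec \<zeta>))"
    and g: "g \<in> gelfand_shilov (1 / 2) (1 / 2)"
  shows "\<exists>\<epsilon>>0. \<exists>C>0. \<forall>z w. norm (L2_pairing (propagator m a t (tf_shift z g)) (tf_shift w g))
           \<le> C * exp (- \<epsilon> * (norm (w - z))\<^sup>2)"
proof -
  let ?g' = "\<lambda>y. cnj (g y)"
  obtain C B e' where e': "C > 0" "B > 0" "e' > 0"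
    and "\<And>j n x. norm (iter_partial (replicate n j) g x) \<le> C * B ^ n * sqrt (fact n) * exp (- (e' * (norm x)\<^sup>2))"
    using gelfand_shilov_half_iter_partial_bound[OF g] by blast
  from this(4)[of 0] have decay: "norm (g y) \<le> C * exp (- (e' * (norm y)\<^sup>2))" for y
    by simp
  have g_meas [measurable]: "g \<in> borel_measurable borel"
    using gelfand_shilov_iter_partial_measurable[OF g, of "[]"] by simp
  have [measurable]: "cnj \<in> borel_measurable borel"
    by (intro borel_measurable_continuous_onI continuous_intros)
  have g_int: "integrable lborel g"
    by (rule Bochner_Integration.integrable_bound[of _ "\<lambda>y. C * exp (- (e' * (norm y)\<^sup>2))"])
       (use integrable_gaussian[OF e'(3), where 'a = "real ^ 'd"] decay e' in auto)
  obtain D K e where D: "D > 0" "K > 0" "e > 0"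
    and FL: "\<And>\<zeta>. norm (fourier_laplace g \<zeta>) \<le> D * exp (K * (norm (Im_vec \<zeta>))\<^sup>2 - e * (norm \<zeta>)\<^sup>2)"
    using fourier_laplace_gelfand_shilov_half_bound[OF g] by blast
  have FL': "norm (fourier_laplace ?g' \<zeta>) \<le> D * exp (K * (norm (Im_vec \<zeta>))\<^sup>2 - e * (norm \<zeta>)\<^sup>2)" for \<zeta>
    using FL[of "\<chi> j. - cnj (\<zeta> $ j)"] by (simp add: fourier_laplace_cnj Im_vec_def norm_vec_def)
  have line_bound: "norm (F (complex_line \<omega> \<theta> w)) \<le> D * exp (K * (\<bar>Im w\<bar> * norm \<theta>)\<^sup>2 - e * (norm (\<omega> + Re w *\<^sub>R \<theta>))\<^sup>2)"
    if F: "\<And>\<zeta>. norm (F \<zeta>) \<le> D * exp (K * (norm (Im_vec \<zeta>))\<^sup>2 - e * (norm \<zeta>)\<^sup>2)"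
    for F :: "complex ^ 'd \<Rightarrow> complex" and \<omega> \<theta> w
  proof -
    have "norm (F (complex_line \<omega> \<theta> w)) \<le> D * exp (K * (\<bar>Im w\<bar> * norm \<theta>)\<^sup>2 - e * (norm (complex_line \<omega> \<theta> w))\<^sup>2)"
      using F[of "complex_line \<omega> \<theta> w"] by (simp add: Im_vec_complex_line)
    also have "\<dots> \<le> D * exp (K * (\<bar>Im w\<bar> * norm \<theta>)\<^sup>2 - e * (norm (\<omega> + Re w *\<^sub>R \<theta>))\<^sup>2)"
      using D by (intro mult_left_mono iffD2[OF exp_le_cancel_iff] diff_left_mono power_mono norm_Re_le_norm_complex_line) auto
    finally show ?thesis .
  qed
  \<comment> \<open>The propagator symbol at time \<open>t\<close>, extended to complex
    frequencies.\<close>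
  define S where "S \<zeta> = fundamental_series m (\<lambda>k. cpoly_eval (a k) \<zeta>) 0 t" for \<zeta>
  define T where "T = t ^ (m - 1)"
  have T: "T \<ge> 0" using t by (simp add: T_def)
  have S_le: "norm (S \<zeta>) \<le> T * exp (C\<^sub>0 * (1 + norm (Im_vec \<zeta>)) * t)" for \<zeta>
    unfolding S_def T_def by (intro norm_fundamental_series_le m t roots) (simp add: op_symbol_def)
  have S_meas [measurable]: "(\<lambda>\<omega>. S (complex_line \<omega> \<theta> w)) \<in> borel_measurable borel" for \<theta> w
    unfolding S_def by measurable
  have S_holo: "(\<lambda>w. S (complex_line \<omega> \<theta> w)) holomorphic_on ball 0 2" for \<omega> \<theta>
    unfolding S_def by (intro fundamental_series_holomorphic_on holomorphic_intros) auto
  have line_0: "complex_line \<omega> 0 0 = complex_vec \<omega>" for \<omega> :: "real ^ 'd"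
    by (simp add: complex_line_def complex_vec_def)
  have symbol: "propagator_symbol m a t \<omega> = S (complex_vec \<omega>)" for \<omega>
    unfolding S_def by (rule propagator_symbol_eq_series[OF m t])
  define I where "I = (LINT y|lborel. exp (- (e / 2 * (norm (y::real ^ 'd))\<^sup>2)))"
  have I: "I \<ge> 0" by (simp add: I_def)
  \<comment> \<open>With this choice the cost of the shift, \<open>2 * K * \<delta>\<^sup>2\<close>
    times the squared distance, is half of the gain \<open>2 * pi * \<delta>\<close>.\<close>
  define \<delta> where "\<delta> = pi / (2 * K)"
  have \<delta>: "\<delta> > 0" "2 * K * \<delta>\<^sup>2 = pi * \<delta>"
    using D by (auto simp: \<delta>_def power2_eq_square)
  \<comment> \<open>\<open>E\<close> collects what does not depend on the phase-space points:
    \<open>C\<^sub>0 * t\<close> and the remainder from completing the square in the linear term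
    \<open>C\<^sub>0 * t * \<delta> * norm (u - x)\<close>.\<close>
  define E where "E = C\<^sub>0 * t + \<delta> * ((C\<^sub>0 * t)\<^sup>2 / (2 * pi))"
  \<comment> \<open>\<open>pi * \<delta> / 2\<close> is the rate that is left in
    \<open>u - x\<close>, and \<open>e / 4\<close> the rate obtained in
    \<open>v - \<xi>\<close>.\<close>
  define \<epsilon> where "\<epsilon> = min (pi * \<delta> / 2) (e / 4)"
  have \<epsilon>: "\<epsilon> > 0" using \<delta> D by (simp add: \<epsilon>_def)
  have "norm (L2_pairing (propagator m a t (tf_shift (x, \<xi>) g)) (tf_shift (u, v) g))
      \<le> (T * D\<^sup>2 * exp E * I + 1) * exp (- \<epsilon> * (norm ((u, v) - (x, \<xi>)))\<^sup>2)" for x \<xi> u v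
  proof -
    \<comment> \<open>The integrand of the matrix coefficient, up to a constant phase, continued to
      complex frequencies; the conjugate transform is expressed through \<open>?g'\<close>.\<close>
    define H where "H \<zeta> = S \<zeta> * (fourier_laplace g (\<zeta> - complex_vec \<xi>)
        * (fourier_laplace ?g' (complex_vec v - \<zeta>) * fourier_kernel \<zeta> (x - u)))" for \<zeta>
    have H_le: "norm (H (complex_line \<omega> \<theta> w)) \<le> T * D\<^sup>2 *
        exp (C\<^sub>0 * (1 + \<bar>Im w\<bar> * norm \<theta>) * t + 2 * K * (\<bar>Im w\<bar> * norm \<theta>)\<^sup>2 + 2 * pi * (Im w * ((x - u) \<bullet> \<theta>))
          - e * (norm (\<omega> - \<xi> + Re w *\<^sub>R \<theta>))\<^sup>2 - e * (norm (\<omega> - v + Re w *\<^sub>R \<theta>))\<^sup>2)" (is "_ \<le> ?R") for \<omega> \<theta> w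
    proof -
      let ?\<zeta> = "complex_line \<omega> \<theta> w"
      have "norm (v - \<omega> + Re w *\<^sub>R (- \<theta>)) = norm (\<omega> - v + Re w *\<^sub>R \<theta>)"
        using norm_minus_cancel[of "\<omega> - v + Re w *\<^sub>R \<theta>"] by (simp add: algebra_simps)
      then have "norm (fourier_laplace ?g' (complex_vec v - ?\<zeta>)) \<le>
          D * exp (K * (\<bar>Im w\<bar> * norm \<theta>)\<^sup>2 - e * (norm (\<omega> - v + Re w *\<^sub>R \<theta>))\<^sup>2)"
        using line_bound[OF FL', of "v - \<omega>" "- \<theta>" w] by (simp add: complex_vec_minus_complex_line)
      moreover have "norm (fourier_laplace g (?\<zeta> - complex_vec \<xi>)) \<le>
          D * exp (K * (\<bar>Im w\<bar> * norm \<theta>)\<^sup>2 - e * (norm (\<omega> - \<xi> + Re w *\<^sub>R \<theta>))\<^sup>2)"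
        using line_bound[OF FL, of "\<omega> - \<xi>" \<theta> w] by (simp add: complex_line_minus_complex_vec)
      moreover have "norm (S ?\<zeta>) \<le> T * exp (C\<^sub>0 * (1 + \<bar>Im w\<bar> * norm \<theta>) * t)"
        using S_le[of ?\<zeta>] by (simp add: Im_vec_complex_line)
      moreover have "norm (fourier_kernel ?\<zeta> (x - u)) \<le> exp (2 * pi * (Im w * ((x - u) \<bullet> \<theta>)))"
        by (simp add: norm_fourier_kernel Im_vec_complex_line)
      ultimately have "norm (H ?\<zeta>) \<le> T * exp (C\<^sub>0 * (1 + \<bar>Im w\<bar> * norm \<theta>) * t) *
          (D * exp (K * (\<bar>Im w\<bar> * norm \<theta>)\<^sup>2 - e * (norm (\<omega> - \<xi> + Re w *\<^sub>R \<theta>))\<^sup>2) *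
          (D * exp (K * (\<bar>Im w\<bar> * norm \<theta>)\<^sup>2 - e * (norm (\<omega> - v + Re w *\<^sub>R \<theta>))\<^sup>2) *
          exp (2 * pi * (Im w * ((x - u) \<bullet> \<theta>)))))"
        unfolding H_def norm_mult using T D by (intro mult_mono) auto
      also have "\<dots> = T * D\<^sup>2 * (exp (C\<^sub>0 * (1 + \<bar>Im w\<bar> * norm \<theta>) * t) *
          exp (K * (\<bar>Im w\<bar> * norm \<theta>)\<^sup>2 - e * (norm (\<omega> - \<xi> + Re w *\<^sub>R \<theta>))\<^sup>2) *
          exp (K * (\<bar>Im w\<bar> * norm \<theta>)\<^sup>2 - e * (norm (\<omega> - v + Re w *\<^sub>R \<theta>))\<^sup>2) *
          exp (2 * pi * (Im w * ((x - u) \<bullet> \<theta>))))"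
        by (simp add: power2_eq_square[of D])
      also have "\<dots> = ?R"
        unfolding exp_add[symmetric] by (simp add: algebra_simps)
      finally show ?thesis .
    qed
    \<comment> \<open>At \<open>w = \<i>\<close> the kernel in \<open>H\<close> then has modulus
      \<open>exp (- 2 * pi * \<delta> * (norm (u - x))\<^sup>2)\<close>.\<close>
    define \<theta> where "\<theta> = \<delta> *\<^sub>R (u - x)"
    have H_meas: "(\<lambda>\<omega>. H (complex_line \<omega> \<theta> w)) \<in> borel_measurable borel" for w
      unfolding H_def fourier_kernel_complex_line by measurable
    have "(LINT \<omega>|lborel. H (complex_line \<omega> \<theta> \<i>)) = (LINT \<omega>|lborel. H (complex_vec \<omega>))"
    proof (rule integral_complex_shift)
      show "(\<lambda>w. H (complex_line \<omega> \<theta> w)) holomorphic_on ball 0 2" for \<omega>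
        unfolding H_def complex_line_minus_complex_vec complex_vec_minus_complex_line fourier_kernel_complex_line
        by (intro holomorphic_intros S_holo fourier_laplace_holomorphic_on[OF _ e'(3)])
           (use decay in auto)
      show "(\<lambda>\<omega>. H (complex_line \<omega> \<theta> w)) \<in> borel_measurable borel" for w
        by (rule H_meas)
      \<comment> \<open>This majorant only has to dominate on the disc, so \<open>M\<close> may
        depend on the phase-space points; the final estimate does not use its size.\<close>
      define M where "M = T * D\<^sup>2 * exp (C\<^sub>0 * (1 + 2 * norm \<theta>) * t + 2 * K * (2 * norm \<theta>)\<^sup>2
        + 2 * pi * (2 * \<bar>(x - u) \<bullet> \<theta>\<bar>) + e * (norm \<xi> + 2 * norm \<theta>)\<^sup>2)"
      show "integrable lborel (\<lambda>\<omega>::real ^ 'd. M * exp (- (e / 2 * (norm \<omega>)\<^sup>2)))"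
        using D by (intro integrable_mult_right integrable_gaussian) auto
      show "norm (H (complex_line \<omega> \<theta> w)) \<le> M * exp (- (e / 2 * (norm \<omega>)\<^sup>2))" if w: "norm w < 2" for w \<omega>
      proof -
        have Re: "\<bar>Re w\<bar> \<le> 2" and Im: "\<bar>Im w\<bar> \<le> 2"
          using w abs_Re_le_cmod[of w] abs_Im_le_cmod[of w] by auto
        have "norm \<omega> \<le> norm (\<omega> - \<xi> + Re w *\<^sub>R \<theta>) + (norm \<xi> + 2 * norm \<theta>)"
        proof -
          have "norm \<omega> = norm ((\<omega> - \<xi> + Re w *\<^sub>R \<theta>) + (\<xi> - Re w *\<^sub>R \<theta>))" by simp
          also have "\<dots> \<le> norm (\<omega> - \<xi> + Re w *\<^sub>R \<theta>) + norm (\<xi> - Re w *\<^sub>R \<theta>)" by (rule norm_triangle_ineq)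
          also have "norm (\<xi> - Re w *\<^sub>R \<theta>) \<le> norm \<xi> + \<bar>Re w\<bar> * norm \<theta>"
            using norm_triangle_ineq4[of \<xi> "Re w *\<^sub>R \<theta>"] by simp
          also have "\<bar>Re w\<bar> * norm \<theta> \<le> 2 * norm \<theta>" using Re by (intro mult_right_mono) auto
          finally show ?thesis by simp
        qed
        then have "(norm \<omega>)\<^sup>2 \<le> (norm (\<omega> - \<xi> + Re w *\<^sub>R \<theta>) + (norm \<xi> + 2 * norm \<theta>))\<^sup>2"
          by (intro power_mono) auto
        also have "\<dots> \<le> 2 * (norm (\<omega> - \<xi> + Re w *\<^sub>R \<theta>))\<^sup>2 + 2 * (norm \<xi> + 2 * norm \<theta>)\<^sup>2"
          by (rule power2_add_le)
        finally have "e / 2 * (norm \<omega>)\<^sup>2 \<le> e / 2 * (2 * (norm (\<omega> - \<xi> + Re w *\<^sub>R \<theta>))\<^sup>2 + 2 * (norm \<xi> + 2 * norm \<theta>)\<^sup>2)"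
          using D by (intro mult_left_mono) auto
        then have *: "- (e * (norm (\<omega> - \<xi> + Re w *\<^sub>R \<theta>))\<^sup>2) \<le> e * (norm \<xi> + 2 * norm \<theta>)\<^sup>2 - e / 2 * (norm \<omega>)\<^sup>2"
          by (simp add: algebra_simps)
        have "C\<^sub>0 * (1 + \<bar>Im w\<bar> * norm \<theta>) * t \<le> C\<^sub>0 * (1 + 2 * norm \<theta>) * t"
          using C\<^sub>0 t Im by (intro mult_right_mono mult_left_mono add_left_mono) auto
        moreover have "2 * K * (\<bar>Im w\<bar> * norm \<theta>)\<^sup>2 \<le> 2 * K * (2 * norm \<theta>)\<^sup>2"
          using D Im by (intro mult_left_mono power_mono mult_right_mono) auto
        moreover have "2 * pi * (Im w * ((x - u) \<bullet> \<theta>)) \<le> 2 * pi * (2 * \<bar>(x - u) \<bullet> \<theta>\<bar>)"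
        proof (intro mult_left_mono)
          have "Im w * ((x - u) \<bullet> \<theta>) \<le> \<bar>Im w\<bar> * \<bar>(x - u) \<bullet> \<theta>\<bar>"
            by (metis abs_ge_self abs_mult)
          also have "\<dots> \<le> 2 * \<bar>(x - u) \<bullet> \<theta>\<bar>" using Im by (intro mult_right_mono) auto
          finally show "Im w * ((x - u) \<bullet> \<theta>) \<le> 2 * \<bar>(x - u) \<bullet> \<theta>\<bar>" .
        qed auto
        moreover have "- (e * (norm (\<omega> - v + Re w *\<^sub>R \<theta>))\<^sup>2) \<le> 0" using D by simp
        ultimately have "C\<^sub>0 * (1 + \<bar>Im w\<bar> * norm \<theta>) * t + 2 * K * (\<bar>Im w\<bar> * norm \<theta>)\<^sup>2 + 2 * pi * (Im w * ((x - u) \<bullet> \<theta>))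
          - e * (norm (\<omega> - \<xi> + Re w *\<^sub>R \<theta>))\<^sup>2 - e * (norm (\<omega> - v + Re w *\<^sub>R \<theta>))\<^sup>2
          \<le> (C\<^sub>0 * (1 + 2 * norm \<theta>) * t + 2 * K * (2 * norm \<theta>)\<^sup>2 + 2 * pi * (2 * \<bar>(x - u) \<bullet> \<theta>\<bar>)
            + e * (norm \<xi> + 2 * norm \<theta>)\<^sup>2) + - (e / 2 * (norm \<omega>)\<^sup>2)"
          using * by linarith
        then have "norm (H (complex_line \<omega> \<theta> w)) \<le> T * D\<^sup>2 * exp ((C\<^sub>0 * (1 + 2 * norm \<theta>) * t + 2 * K * (2 * norm \<theta>)\<^sup>2 + 2 * pi * (2 * \<bar>(x - u) \<bullet> \<theta>\<bar>)
            + e * (norm \<xi> + 2 * norm \<theta>)\<^sup>2) + - (e / 2 * (norm \<omega>)\<^sup>2))"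
          using T by (intro order.trans[OF H_le] mult_left_mono iffD2[OF exp_le_cancel_iff]) auto
        then show ?thesis by (simp only: M_def exp_add[of _ "- _"] mult.assoc)
      qed
    qed
    moreover have H_shift_le: "norm (H (complex_line \<omega> \<theta> \<i>)) \<le>
        T * D\<^sup>2 * exp E * exp (- \<epsilon> * (norm ((u, v) - (x, \<xi>)))\<^sup>2) * exp (- (e / 2 * (norm (- \<xi> + \<omega>))\<^sup>2))" for \<omega>
    proof -
      let ?k = "norm (u - x)"
      have inner: "(x - u) \<bullet> \<theta> = - (\<delta> * ?k\<^sup>2)"
        by (simp add: \<theta>_def power2_norm_eq_inner inner_diff_left inner_diff_right algebra_simps)
      have \<theta>: "norm \<theta> = \<delta> * ?k" using \<delta> by (simp add: \<theta>_def)
      have sq: "2 * K * (\<delta> * ?k)\<^sup>2 = pi * \<delta> * ?k\<^sup>2"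
        using \<delta>(2) by (simp add: power_mult_distrib)
      have "0 \<le> \<delta> * ((C\<^sub>0 * t - pi * ?k)\<^sup>2 / (2 * pi))" using \<delta> by simp
      also have "\<dots> = \<delta> * ((C\<^sub>0 * t)\<^sup>2 / (2 * pi)) - C\<^sub>0 * t * (\<delta> * ?k) + pi * \<delta> / 2 * ?k\<^sup>2"
        by (simp add: power2_eq_square field_simps)
      finally have 1: "C\<^sub>0 * (1 + \<delta> * ?k) * t + 2 * K * (\<delta> * ?k)\<^sup>2 + 2 * pi * (- (\<delta> * ?k\<^sup>2)) \<le> E - pi * \<delta> / 2 * ?k\<^sup>2"
        unfolding sq E_def by (simp add: algebra_simps)
      \<comment> \<open>Half of the Gaussian around \<xi> is kept for the integration in \<omega>;
        the rest, together with the Gaussian around \<open>v\<close>, gives decay in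
        \<open>v - \<xi>\<close> by the triangle inequality.\<close>
      have "norm (v - \<xi>) \<le> norm (\<omega> - \<xi>) + norm (\<omega> - v)"
        using norm_triangle_ineq4[of "\<omega> - \<xi>" "\<omega> - v"] by simp
      then have "(norm (v - \<xi>))\<^sup>2 \<le> (norm (\<omega> - \<xi>) + norm (\<omega> - v))\<^sup>2"
        by (intro power_mono) auto
      also have "\<dots> \<le> 2 * (norm (\<omega> - \<xi>))\<^sup>2 + 2 * (norm (\<omega> - v))\<^sup>2"
        by (rule power2_add_le)
      finally have "e / 4 * (norm (v - \<xi>))\<^sup>2 \<le> e / 4 * (2 * (norm (\<omega> - \<xi>))\<^sup>2 + 2 * (norm (\<omega> - v))\<^sup>2)"
        using D by (intro mult_left_mono) auto
      moreover have "0 \<le> e * (norm (\<omega> - v))\<^sup>2" using D by simp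
      ultimately have 2: "- (e * (norm (\<omega> - \<xi>))\<^sup>2) - e * (norm (\<omega> - v))\<^sup>2 \<le>
          - (e / 4 * (norm (v - \<xi>))\<^sup>2) - e / 2 * (norm (\<omega> - \<xi>))\<^sup>2"
        by (simp add: algebra_simps)
      have "\<epsilon> * ?k\<^sup>2 \<le> pi * \<delta> / 2 * ?k\<^sup>2" "\<epsilon> * (norm (v - \<xi>))\<^sup>2 \<le> e / 4 * (norm (v - \<xi>))\<^sup>2"
        by (intro mult_right_mono; simp add: \<epsilon>_def)+
      moreover have "(norm ((u, v) - (x, \<xi>)))\<^sup>2 = ?k\<^sup>2 + (norm (v - \<xi>))\<^sup>2"
        by (simp add: norm_Pair)
      ultimately have 3: "\<epsilon> * (norm ((u, v) - (x, \<xi>)))\<^sup>2 \<le> pi * \<delta> / 2 * ?k\<^sup>2 + e / 4 * (norm (v - \<xi>))\<^sup>2"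
        by (simp only: distrib_left)
      have "norm (H (complex_line \<omega> \<theta> \<i>)) \<le> T * D\<^sup>2 *
          exp (C\<^sub>0 * (1 + \<delta> * ?k) * t + 2 * K * (\<delta> * ?k)\<^sup>2 + 2 * pi * (- (\<delta> * ?k\<^sup>2))
            - e * (norm (\<omega> - \<xi>))\<^sup>2 - e * (norm (\<omega> - v))\<^sup>2)"
        using H_le[of \<omega> \<theta> \<i>] by (simp add: inner \<theta>)
      also have "\<dots> \<le> T * D\<^sup>2 * exp (E + - \<epsilon> * (norm ((u, v) - (x, \<xi>)))\<^sup>2 + - (e / 2 * (norm (\<omega> - \<xi>))\<^sup>2))"
        using T 1 2 3 by (intro mult_left_mono iffD2[OF exp_le_cancel_iff]) auto
      also have "\<omega> - \<xi> = - \<xi> + \<omega>" by simp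
      finally show ?thesis by (simp only: exp_add mult.assoc)
    qed
    have "norm (LINT \<omega>|lborel. H (complex_line \<omega> \<theta> \<i>)) \<le>
      (LINT \<omega>|lborel. T * D\<^sup>2 * exp E * exp (- \<epsilon> * (norm ((u, v) - (x, \<xi>)))\<^sup>2) * exp (- (e / 2 * (norm (- \<xi> + \<omega>))\<^sup>2)))"
      (is "_ \<le> (LINT \<omega>|lborel. ?M * _ \<omega>)")
    proof (rule Bochner_Integration.integral_norm_bound_integral)
      show int: "integrable lborel (\<lambda>\<omega>. ?M * exp (- (e / 2 * (norm (- \<xi> + \<omega>))\<^sup>2)))"
        using D by (intro integrable_mult_right integrable_lborel_translation[OF integrable_gaussian]) auto
      show "integrable lborel (\<lambda>\<omega>. H (complex_line \<omega> \<theta> \<i>))"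
        by (rule Bochner_Integration.integrable_bound[OF int])
           (use H_meas in simp, intro AE_I2 order.trans[OF H_shift_le], simp)
    qed (rule H_shift_le)
    moreover have "(LINT \<omega>|lborel. exp (- (e / 2 * (norm (- \<xi> + \<omega>))\<^sup>2))) = I"
      unfolding I_def by (rule integral_lborel_translation) measurable
    ultimately have J: "norm (LINT \<omega>|lborel. H (complex_vec \<omega>)) \<le>
        T * D\<^sup>2 * exp E * I * exp (- \<epsilon> * (norm ((u, v) - (x, \<xi>)))\<^sup>2)"
      by (simp add: mult_ac)
    define h where "h \<omega> = propagator_symbol m a t \<omega> * fourier (tf_shift (x, \<xi>) g) \<omega>" for \<omega>
    \<comment> \<open>\<open>complex_line \<omega> 0 0\<close> writes a real frequency in the form
      for which the measurability rules are stated.\<close>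
    have h_eq: "h \<omega> = S (complex_line \<omega> 0 0) * (exp (- 2 * of_real pi * \<i> * of_real (x \<bullet> (\<omega> - \<xi>)))
        * fourier_laplace g (complex_line \<omega> 0 0 - complex_vec \<xi>))" for \<omega>
      unfolding h_def symbol fourier_tf_shift[OF g_meas] fourier_eq_fourier_laplace[of g] line_0 complex_vec_diff ..
    \<comment> \<open>On real frequencies the symbol is bounded by
      \<open>T * exp (C\<^sub>0 * t)\<close>, so the Gaussian decay of the transform of the window
      gives integrability.\<close>
    have "integrable lborel h"
    proof (rule Bochner_Integration.integrable_bound)
      show "integrable lborel (\<lambda>\<omega>. T * exp (C\<^sub>0 * t) * (D * exp (- (e * (norm (- \<xi> + \<omega>))\<^sup>2))))"
        using D by (intro integrable_mult_right integrable_lborel_translation[OF integrable_gaussian]) auto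
      show "h \<in> borel_measurable lborel"
        unfolding h_eq[abs_def] by measurable
      have "norm (h \<omega>) \<le> T * exp (C\<^sub>0 * t) * (D * exp (- (e * (norm (- \<xi> + \<omega>))\<^sup>2)))" for \<omega>
      proof -
        have "norm (h \<omega>) = norm (S (complex_line \<omega> 0 0)) * norm (fourier_laplace g (complex_line (\<omega> - \<xi>) 0 0))"
          unfolding h_eq complex_line_minus_complex_vec by (simp add: norm_mult norm_exp_eq_Re)
        also have "\<dots> \<le> (T * exp (C\<^sub>0 * t)) * (D * exp (- (e * (norm (\<omega> - \<xi>))\<^sup>2)))"
          using S_le[of "complex_line \<omega> 0 0"] line_bound[OF FL, of "\<omega> - \<xi>" 0 0] T
          by (intro mult_mono) (auto simp: Im_vec_complex_line)
        finally show ?thesis by simp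
      qed
      then show "AE \<omega> in lborel. norm (h \<omega>) \<le> norm (T * exp (C\<^sub>0 * t) * (D * exp (- (e * (norm (- \<xi> + \<omega>))\<^sup>2))))"
        using T D by auto
    qed
    then have "L2_pairing (propagator m a t (tf_shift (x, \<xi>) g)) (tf_shift (u, v) g)
        = (LINT \<omega>|lborel. h \<omega> * cnj (fourier (tf_shift (u, v) g) \<omega>))"
      unfolding propagator_def fourier_multiplier_def h_def[symmetric]
      by (rule L2_pairing_inverse_fourier) (rule integrable_tf_shift[OF g_int])
    \<comment> \<open>The phases of the two shifts combine to the kernel at \<open>x - u\<close> and
      a factor of modulus 1 that is independent of \<omega>.\<close>
    also have "\<dots> = (LINT \<omega>|lborel. exp (2 * of_real pi * \<i> * of_real (x \<bullet> \<xi> - u \<bullet> v)) * H (complex_vec \<omega>))"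
    proof (rule Bochner_Integration.integral_cong)
      fix \<omega>
      let ?e = "\<lambda>r::real. exp (2 * of_real pi * \<i> * of_real r) :: complex"
      have e_mult: "?e r * ?e s = ?e (r + s)" for r s
        by (simp add: exp_add[symmetric] algebra_simps)
      have "fourier_laplace ?g' (complex_vec v - complex_vec \<omega>) = cnj (fourier g (\<omega> - v))"
        unfolding fourier_laplace_cnj fourier_eq_fourier_laplace
        by (simp add: complex_vec_def)
      then have "cnj (fourier (tf_shift (u, v) g) \<omega>) = ?e (u \<bullet> (\<omega> - v)) * fourier_laplace ?g' (complex_vec v - complex_vec \<omega>)"
        by (simp add: fourier_tf_shift exp_cnj)
      moreover have "h \<omega> = S (complex_vec \<omega>) * (?e (- (x \<bullet> (\<omega> - \<xi>))) * fourier_laplace g (complex_vec \<omega> - complex_vec \<xi>))"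
        unfolding h_eq line_0 by simp
      moreover have "fourier_kernel (complex_vec \<omega>) (x - u) = ?e (- ((x - u) \<bullet> \<omega>))"
        using fourier_kernel_complex_line[of \<omega> 0 0 "x - u"] by (simp add: line_0)
      moreover have "?e (u \<bullet> (\<omega> - v)) * ?e (- (x \<bullet> (\<omega> - \<xi>))) = ?e (x \<bullet> \<xi> - u \<bullet> v) * ?e (- ((x - u) \<bullet> \<omega>))"
        unfolding e_mult by (simp add: algebra_simps)
      ultimately show "h \<omega> * cnj (fourier (tf_shift (u, v) g) \<omega>) = ?e (x \<bullet> \<xi> - u \<bullet> v) * H (complex_vec \<omega>)"
        unfolding H_def by (simp only: mult.assoc mult.left_commute mult.commute)
    qed simp
    finally have "norm (L2_pairing (propagator m a t (tf_shift (x, \<xi>) g)) (tf_shift (u, v) g))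
        = norm (LINT \<omega>|lborel. H (complex_vec \<omega>))"
      by (simp add: norm_mult norm_exp_eq_Re)
    also note J
    \<comment> \<open>Adding 1 keeps the constant positive even when \<open>T = 0\<close>, as
      happens for \<open>t = 0\<close> and \<open>m > 1\<close>.\<close>
    also have "T * D\<^sup>2 * exp E * I * exp (- \<epsilon> * (norm ((u, v) - (x, \<xi>)))\<^sup>2)
        \<le> (T * D\<^sup>2 * exp E * I + 1) * exp (- \<epsilon> * (norm ((u, v) - (x, \<xi>)))\<^sup>2)"
      by (intro mult_right_mono) auto
    finally show ?thesis .
  qed
  moreover have "T * D\<^sup>2 * exp E * I + 1 > 0"
    using T I by (intro add_nonneg_pos) auto
  ultimately show ?thesis
    using \<epsilon> by (intro exI[of _ \<epsilon>] exI[of _ "T * D\<^sup>2 * exp E * I + 1"] conjI) auto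
qed

theorem proposition5p4:
  fixes m :: nat and a :: "nat \<Rightarrow> 'd::finite cpoly"
  assumes "m \<ge> 1"
    and "hyperbolic m a"
  shows "(\<exists>C\<^sub>0>0. \<forall>(\<tau>::complex) (\<zeta>::complex ^ 'd).
            op_symbol m a (\<i> * \<tau>) \<zeta> = 0 \<longrightarrow> Im \<tau> \<ge> - C\<^sub>0 * (1 + norm (Im_vec \<zeta>)))
       \<and> (\<forall>g \<in> gelfand_shilov (1/2) (1/2). \<forall>t\<ge>0. \<exists>\<epsilon>>0. \<exists>C>0.
            \<forall>(z::(real ^ 'd) \<times> (real ^ 'd)) (w::(real ^ 'd) \<times> (real ^ 'd)).
              norm (L2_pairing (propagator m a t (tf_shift z g)) (tf_shift w g))
                \<le> C * exp (- \<epsilon> * (norm (w - z))\<^sup>2))"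
proof -
  obtain C\<^sub>0 where C\<^sub>0: "C\<^sub>0 > 0" "\<And>s \<zeta>. op_symbol m a s \<zeta> = 0 \<Longrightarrow> Re s \<le> C\<^sub>0 * (1 + norm (Im_vec \<zeta>))"
    using hyperbolic_complex_bound[OF assms] by blast
  \<comment> \<open>The real part of \<open>\<i> * \<tau>\<close> is \<open>- Im \<tau>\<close>, so
    the upper bound on \<open>Re s\<close> becomes a lower bound on
    \<open>Im \<tau>\<close>.\<close>
  have "\<forall>\<tau> \<zeta>. op_symbol m a (\<i> * \<tau>) \<zeta> = 0 \<longrightarrow> Im \<tau> \<ge> - C\<^sub>0 * (1 + norm (Im_vec \<zeta>))"
    using C\<^sub>0(2) by fastforce
  with C\<^sub>0(1) have "\<exists>C\<^sub>0>0. \<forall>\<tau> \<zeta>. op_symbol m a (\<i> * \<tau>) \<zeta> = 0 \<longrightarrow> Im \<tau> \<ge> - C\<^sub>0 * (1 + norm (Im_vec \<zeta>))"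
    by blast
  with propagator_pairing_bound[OF assms(1) _ C\<^sub>0] show ?thesis by blast
qed

end
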